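(* Let $N\ge 2$ and let $f\colon\mathbb{R}^N\to[0,+\infty]$ be a Borel function such that $f\in L^1_{\mathrm{loc}}(\mathbb{R}^N)$. For every convex body $E\subset\mathbb{R}^N$ let $$P_f(E)=\int_{\partial E} f(x)\,\mathrm{d}\mathscr{H}^{N-1}(x).$$ If $P_f(A)\le P_f(B)$ for any two convex bodies $A,B\subset\mathbb{R}^N$ with $A\subset B$, then there exists a constant $c\ge 0$ such that $f(x)=c$ for Lebesgue-a.e. $x\in\mathbb{R}^N$.
   Context: A convex body in $\mathbb{R}^N$ is a compact convex subset of $\mathbb{R}^N$ with non-empty interior. $\mathscr{H}^{N-1}$ denotes the $(N-1)$-dimensional Hausdorff measure on $\mathbb{R}^N$, and $\partial E$ is the topological boundary of $E$. The value $P_f(E)$ is allowed to be $+\infty$. *)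

theory Defs
  imports "HOL-Analysis.Analysis"
begin

section \<open>Hausdorff measure\<close>

text \<open>
  The normalisation with the volume \<^term>\<open>unit_ball_vol (real k)\<close> of the \<open>k\<close>-dimensional
  unit ball is the usual one, for which \<open>k\<close>-dimensional Hausdorff measure on
  \<open>k\<close>-dimensional Euclidean space is Lebesgue measure. The case distinction for the empty set matters only
  for \<open>k = 0\<close>, where \<^term>\<open>(0::real) ^ 0 = 1\<close>.
\<close>

definition hausdorff_gauge :: "nat \<Rightarrow> 'a::metric_space set \<Rightarrow> ennreal" where
  "hausdorff_gauge k C =
     (if C = {} then 0 else ennreal (unit_ball_vol (real k) * (diameter C / 2) ^ k))"

text \<open>
  Boundedness is required explicitly because \<^const>\<open>diameter\<close> is real-valued and has an
  arbitrary value on unbounded sets. If there is no countable cover, the infimum is infinite.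
\<close>

definition hausdorff_premeasure :: "nat \<Rightarrow> real \<Rightarrow> 'a::metric_space set \<Rightarrow> ennreal" where
  "hausdorff_premeasure k \<delta> A =
     (INF C\<in>{C :: nat \<Rightarrow> 'a set. A \<subseteq> (\<Union>i. C i) \<and> (\<forall>i. bounded (C i) \<and> diameter (C i) \<le> \<delta>)}.
        \<Sum>i. hausdorff_gauge k (C i))"

definition hausdorff_outer_measure :: "nat \<Rightarrow> 'a::metric_space set \<Rightarrow> ennreal" where
  "hausdorff_outer_measure k A = (SUP \<delta>\<in>{0<..}. hausdorff_premeasure k \<delta> A)"

text \<open>
  \<^const>\<open>measure_of\<close> yields the null measure if its last argument is not a measure; that this
  does not happen here is shown in \<open>emeasure_hausdorff_measure\<close> below.
\<close>

definition hausdorff_measure :: "nat \<Rightarrow> 'a::metric_space measure" where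
  "hausdorff_measure k = measure_of UNIV (sets borel) (hausdorff_outer_measure k)"

lemma space_hausdorff_measure [simp]: "space (hausdorff_measure k) = UNIV"
  by (simp add: hausdorff_measure_def space_measure_of_conv)

lemma sets_hausdorff_measure [simp, measurable_cong]: "sets (hausdorff_measure k) = sets borel"
  using sets.sets_measure_of_eq[of borel "hausdorff_outer_measure k"]
  by (simp add: hausdorff_measure_def)

lemma hausdorff_gauge_empty [simp]: "hausdorff_gauge k {} = 0"
  by (simp add: hausdorff_gauge_def)

lemma hausdorff_gauge_mono:
  assumes "C \<subseteq> D" "bounded D"
  shows "hausdorff_gauge k C \<le> hausdorff_gauge k D"
proof (cases "C = {}")
  case False
  have "0 \<le> diameter C"
    using assms bounded_subset diameter_ge_0 by blast
  then have "(diameter C / 2) ^ k \<le> (diameter D / 2) ^ k"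
    using diameter_subset[OF assms] by (intro power_mono) auto
  then show ?thesis
    using False assms(1) by (auto simp: hausdorff_gauge_def intro!: ennreal_leI mult_left_mono)
qed simp

lemma hausdorff_premeasure_le:
  assumes "A \<subseteq> (\<Union>i. C i)" "\<And>i. bounded (C i)" "\<And>i. diameter (C i) \<le> \<delta>"
  shows "hausdorff_premeasure k \<delta> A \<le> (\<Sum>i. hausdorff_gauge k (C i))"
  unfolding hausdorff_premeasure_def using assms by (intro INF_lower) auto

lemma hausdorff_premeasure_mono:
  assumes "A \<subseteq> B"
  shows "hausdorff_premeasure k \<delta> A \<le> hausdorff_premeasure k \<delta> B"
  unfolding hausdorff_premeasure_def using assms by (intro INF_superset_mono) auto

lemma hausdorff_premeasure_antimono:
  assumes "\<delta> \<le> \<epsilon>"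
  shows "hausdorff_premeasure k \<epsilon> A \<le> hausdorff_premeasure k \<delta> A"
  unfolding hausdorff_premeasure_def using assms by (intro INF_superset_mono) (auto intro: order_trans)

lemma hausdorff_premeasure_UN:
  fixes A :: "nat \<Rightarrow> 'a::metric_space set"
  shows "hausdorff_premeasure k \<delta> (\<Union>n. A n) \<le> (\<Sum>n. hausdorff_premeasure k \<delta> (A n))"
proof (rule ennreal_le_epsilon)
  let ?P = "hausdorff_premeasure k \<delta>" and ?g = "hausdorff_gauge k"
  fix e :: real assume "0 < e" and fin: "(\<Sum>n. ?P (A n)) < top"
  then have *: "?P (A n) < ?P (A n) + e * (1/2)^Suc n" for n
    by (auto simp add: less_top dest!: ennreal_suminf_lessD)
  have "\<exists>C. A n \<subseteq> (\<Union>i. C i) \<and> (\<forall>i. bounded (C i) \<and> diameter (C i) \<le> \<delta>) \<and>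
          (\<Sum>i. ?g (C i)) \<le> ?P (A n) + e * (1/2)^Suc n" for n
    using *[of n] unfolding hausdorff_premeasure_def[of k \<delta> "A n"] INF_less_iff
    by (auto intro: less_imp_le)
  then obtain B where B: "\<And>n. A n \<subseteq> (\<Union>i. B n i)" "\<And>n i. bounded (B n i)"
      "\<And>n i. diameter (B n i) \<le> \<delta>" "\<And>n. (\<Sum>i. ?g (B n i)) \<le> ?P (A n) + e * (1/2)^Suc n"
    by metis
  define C where "C = case_prod B o prod_decode"
  have "(\<Union>n. A n) \<subseteq> (\<Union>i. C i)"
    using B(1) by (auto simp add: C_def subset_eq) (metis prod.case prod_encode_inverse)
  then have "?P (\<Union>n. A n) \<le> (\<Sum>i. ?g (C i))"
    by (rule hausdorff_premeasure_le) (auto simp: C_def split_def B)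
  also have "\<dots> = (\<Sum>n. \<Sum>i. ?g (B n i))"
    unfolding C_def comp_def
    using suminf_ennreal_2dimen[of "\<lambda>n. \<Sum>i. ?g (B n i)" "\<lambda>p. ?g (case_prod B p)"] by simp
  also have "\<dots> \<le> (\<Sum>n. ?P (A n) + e * (1/2) ^ Suc n)"
    by (intro suminf_le allI B) auto
  also have "\<dots> = (\<Sum>n. ?P (A n)) + (\<Sum>n. ennreal e * ennreal ((1/2) ^ Suc n))"
    using \<open>0 < e\<close> by (subst suminf_add[symmetric])
      (auto simp del: ennreal_suminf_cmult simp add: ennreal_mult[symmetric])
  also have "\<dots> = (\<Sum>n. ?P (A n)) + e"
    unfolding ennreal_suminf_cmult
    by (subst suminf_ennreal_eq[OF zero_le_power power_half_series]) auto
  finally show "?P (\<Union>n. A n) \<le> (\<Sum>n. ?P (A n)) + e" .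
qed

lemma hausdorff_premeasure_le_outer:
  "0 < \<delta> \<Longrightarrow> hausdorff_premeasure k \<delta> A \<le> hausdorff_outer_measure k A"
  unfolding hausdorff_outer_measure_def by (intro SUP_upper) auto

lemma hausdorff_outer_measure_empty [simp]:
  "hausdorff_outer_measure k ({} :: 'a::metric_space set) = 0"
proof -
  have "hausdorff_premeasure k \<delta> ({} :: 'a set) = 0" if "0 < \<delta>" for \<delta>
    using hausdorff_premeasure_le[of "{}" "\<lambda>_. {} :: 'a set" \<delta> k] that by simp
  then show ?thesis
    by (simp add: hausdorff_outer_measure_def)
qed

lemma hausdorff_outer_measure_mono:
  "A \<subseteq> B \<Longrightarrow> hausdorff_outer_measure k A \<le> hausdorff_outer_measure k B"
  unfolding hausdorff_outer_measure_def by (intro SUP_mono') (rule hausdorff_premeasure_mono)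

lemma hausdorff_outer_measure_UN:
  fixes A :: "nat \<Rightarrow> 'a::metric_space set"
  shows "hausdorff_outer_measure k (\<Union>n. A n) \<le> (\<Sum>n. hausdorff_outer_measure k (A n))"
  unfolding hausdorff_outer_measure_def[of k "\<Union>n. A n"]
proof (rule SUP_least)
  fix \<delta> :: real assume "\<delta> \<in> {0<..}"
  then have "(\<Sum>n. hausdorff_premeasure k \<delta> (A n)) \<le> (\<Sum>n. hausdorff_outer_measure k (A n))"
    by (intro suminf_le hausdorff_premeasure_le_outer) auto
  with hausdorff_premeasure_UN[of k \<delta> A]
  show "hausdorff_premeasure k \<delta> (\<Union>n. A n) \<le> (\<Sum>n. hausdorff_outer_measure k (A n))"
    by (rule order_trans)
qed

lemma outer_measure_space_hausdorff:
  "outer_measure_space (Pow UNIV) (hausdorff_outer_measure k)"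
  by (auto simp: outer_measure_space_def positive_def increasing_def countably_subadditive_def
      intro: hausdorff_outer_measure_mono hausdorff_outer_measure_UN)

lemma hausdorff_outer_measure_Un:
  "hausdorff_outer_measure k (A \<union> B) \<le> hausdorff_outer_measure k A + hausdorff_outer_measure k B"
  using hausdorff_outer_measure_UN[of k "binaryset A B"]
  by (simp add: UN_binaryset_eq suminf_binaryset_eq)

lemma hausdorff_outer_measure_separated:
  assumes "0 < d" and sep: "\<And>x y. x \<in> A \<Longrightarrow> y \<in> B \<Longrightarrow> d \<le> dist x y"
  shows "hausdorff_outer_measure k A + hausdorff_outer_measure k B \<le> hausdorff_outer_measure k (A \<union> B)"
proof -
  let ?P = "hausdorff_premeasure k" and ?g = "hausdorff_gauge k"
  have *: "?P \<delta> A + ?P \<delta> B \<le> hausdorff_outer_measure k (A \<union> B)" if "0 < \<delta>" "\<delta> < d" for \<delta>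
  proof -
    have "?P \<delta> A + ?P \<delta> B \<le> ?P \<delta> (A \<union> B)"
      unfolding hausdorff_premeasure_def[of k \<delta> "A \<union> B"]
    proof (rule INF_greatest)
      fix C assume "C \<in> {C. A \<union> B \<subseteq> (\<Union>i::nat. C i) \<and> (\<forall>i. bounded (C i) \<and> diameter (C i) \<le> \<delta>)}"
      then have C: "A \<union> B \<subseteq> (\<Union>i. C i)" "\<And>i. bounded (C i)" "\<And>i. diameter (C i) \<le> \<delta>"
        by auto
      have sub: "bounded (C i \<inter> S)" "diameter (C i \<inter> S) \<le> \<delta>" for i S
        using C(2,3)[of i] diameter_subset[of "C i \<inter> S" "C i"] by (auto intro: bounded_subset)
      have "?P \<delta> A \<le> (\<Sum>i. ?g (C i \<inter> A))" "?P \<delta> B \<le> (\<Sum>i. ?g (C i \<inter> B))"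
        using C(1) sub by (auto intro!: hausdorff_premeasure_le)
      then have "?P \<delta> A + ?P \<delta> B \<le> (\<Sum>i. ?g (C i \<inter> A)) + (\<Sum>i. ?g (C i \<inter> B))"
        by (rule add_mono)
      also have "\<dots> = (\<Sum>i. ?g (C i \<inter> A) + ?g (C i \<inter> B))"
        by (simp add: suminf_add)
      also have "\<dots> \<le> (\<Sum>i. ?g (C i))"
      proof (intro suminf_le)
        fix i
        have "C i \<inter> A = {} \<or> C i \<inter> B = {}"
        proof (rule ccontr)
          assume "\<not> ?thesis"
          then obtain x y where "x \<in> C i" "x \<in> A" "y \<in> C i" "y \<in> B"
            by auto
          with sep[of x y] diameter_bounded_bound[OF C(2), of x i y] C(3)[of i] \<open>\<delta> < d\<close>
          show False by linarith
        qed
        then show "?g (C i \<inter> A) + ?g (C i \<inter> B) \<le> ?g (C i)"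
          using hausdorff_gauge_mono[of "C i \<inter> _" "C i" k] C(2) by auto
      qed auto
      finally show "?P \<delta> A + ?P \<delta> B \<le> (\<Sum>i. ?g (C i))" .
    qed
    also have "\<dots> \<le> hausdorff_outer_measure k (A \<union> B)"
      using that by (intro hausdorff_premeasure_le_outer)
    finally show ?thesis .
  qed
  have **: "?P \<delta> A + ?P \<epsilon> B \<le> hausdorff_outer_measure k (A \<union> B)" if "0 < \<delta>" "0 < \<epsilon>" for \<delta> \<epsilon>
  proof -
    let ?m = "min (min \<delta> \<epsilon>) (d / 2)"
    have "?P \<delta> A + ?P \<epsilon> B \<le> ?P ?m A + ?P ?m B"
      by (intro add_mono hausdorff_premeasure_antimono) auto
    also have "\<dots> \<le> hausdorff_outer_measure k (A \<union> B)"
      using that \<open>0 < d\<close> by (intro *) auto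
    finally show ?thesis .
  qed
  have ne: "{0::real<..} \<noteq> {}"
    by (metis greaterThan_iff empty_iff zero_less_one)
  have "?P \<delta> A + hausdorff_outer_measure k B \<le> hausdorff_outer_measure k (A \<union> B)" if "0 < \<delta>" for \<delta>
    unfolding hausdorff_outer_measure_def[of k B]
    using that by (simp add: ennreal_SUP_add_right[OF ne]) (auto intro!: SUP_least **)
  then show ?thesis
    unfolding hausdorff_outer_measure_def[of k A]
    by (simp add: ennreal_SUP_add_left[OF ne, symmetric]) (auto intro!: SUP_least)
qed

lemma closed_hausdorff_caratheodory:
  fixes C T :: "'a::metric_space set"
  assumes "closed C"
  shows "hausdorff_outer_measure k (T \<inter> C) + hausdorff_outer_measure k (T - C)
           \<le> hausdorff_outer_measure k T"
proof (cases "C = {} \<or> hausdorff_outer_measure k T = top")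
  case True
  then show ?thesis by auto
next
  case False
  then have "C \<noteq> {}" and fin: "hausdorff_outer_measure k T < top"
    by (auto simp: less_top)
  let ?H = "hausdorff_outer_measure k"
  define A where "A n = {x\<in>T. 1 / real (Suc n) \<le> infdist x C}" for n
  define R where "R n = A (Suc n) - A n" for n
  have A_mono: "A m \<subseteq> A n" if "m \<le> n" for m n
  proof -
    have "1 / real (Suc n) \<le> 1 / real (Suc m)"
      using that by (intro divide_left_mono) auto
    then show ?thesis
      unfolding A_def by auto
  qed
  have RT: "R n \<subseteq> T" for n
    by (auto simp: R_def A_def)
  have near: "?H (T \<inter> C) + ?H (A n) \<le> ?H T" for n
  proof -
    have "?H (T \<inter> C) + ?H (A n) \<le> ?H ((T \<inter> C) \<union> A n)"
    proof (rule hausdorff_outer_measure_separated)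
      fix x y assume "x \<in> T \<inter> C" "y \<in> A n"
      then show "1 / real (Suc n) \<le> dist x y"
        using infdist_le[of x C y] by (auto simp: A_def dist_commute)
    qed simp
    also have "\<dots> \<le> ?H T"
      by (intro hausdorff_outer_measure_mono) (auto simp: A_def)
    finally show ?thesis .
  qed
  have alt: "(\<Sum>i<m. ?H (R (2 * i + p))) \<le> ?H (\<Union>i<m. R (2 * i + p))" for m p
  proof (induction m)
    case (Suc m)
    show ?case
    proof (cases "m = 0")
      case False
      define q where "q = 2 * m + p"
      have "q > 0"
        using False by (simp add: q_def)
      have "?H (\<Union>i<m. R (2 * i + p)) + ?H (R q) \<le> ?H ((\<Union>i<m. R (2 * i + p)) \<union> R q)"
      proof (rule hausdorff_outer_measure_separated)
        show "0 < 1 / real q - 1 / real (Suc q)"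
          using \<open>q > 0\<close> by (simp add: divide_strict_left_mono)
        fix x y assume x: "x \<in> (\<Union>i<m. R (2 * i + p))" and y: "y \<in> R q"
        from x obtain i where "i < m" "x \<in> A (Suc (2 * i + p))"
          by (auto simp: R_def)
        moreover have "Suc (2 * i + p) \<le> q - 1"
          using \<open>i < m\<close> by (auto simp: q_def)
        ultimately have "x \<in> A (q - 1)"
          using A_mono by blast
        then have "1 / real q \<le> infdist x C"
          using \<open>q > 0\<close> by (simp add: A_def)
        moreover have "infdist y C < 1 / real (Suc q)"
          using y by (auto simp: R_def A_def)
        ultimately show "1 / real q - 1 / real (Suc q) \<le> dist x y"
          using infdist_triangle[of x C y] by linarith
      qed
      then have "(\<Sum>i<Suc m. ?H (R (2 * i + p))) \<le> ?H ((\<Union>i<m. R (2 * i + p)) \<union> R q)"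
        using Suc.IH by (simp add: q_def) (meson add_right_mono order_trans)
      also have "(\<Union>i<m. R (2 * i + p)) \<union> R q = (\<Union>i<Suc m. R (2 * i + p))"
        by (auto simp: q_def lessThan_Suc)
      finally show ?thesis .
    qed (simp add: lessThan_Suc)
  qed simp
  have alt': "(\<Sum>i<m. ?H (R (2 * i + p))) \<le> ?H T" for m p
    by (rule order_trans[OF alt hausdorff_outer_measure_mono]) (use RT in auto)
  have split: "(\<Sum>n<2 * m. ?H (R n)) = (\<Sum>i<m. ?H (R (2 * i + 0))) + (\<Sum>i<m. ?H (R (2 * i + 1)))" for m
    by (induction m) (simp_all add: ac_simps)
  have "(\<Sum>n. ?H (R n)) \<le> ?H T + ?H T"
  proof (intro suminf_le_const summableI)
    fix m
    have "(\<Sum>n<m. ?H (R n)) \<le> (\<Sum>n<2 * m. ?H (R n))"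
      by (intro sum_mono2) auto
    also have "\<dots> \<le> ?H T + ?H T"
      unfolding split by (intro add_mono alt')
    finally show "(\<Sum>n<m. ?H (R n)) \<le> ?H T + ?H T" .
  qed
  also have "\<dots> < top"
    using fin by simp
  finally have sum_fin: "(\<Sum>n. ?H (R n)) < top" .
  show ?thesis
  proof (rule ennreal_le_epsilon)
    fix e :: real assume "0 < e"
    let ?S = "\<Sum>n. ?H (R n)"
    have "\<exists>n. ?S \<le> ennreal e + (\<Sum>j<n. ?H (R j))"
    proof (cases "?S = 0")
      case False
      then have "?S - ennreal e < ?S"
        using sum_fin \<open>0 < e\<close> by (intro ennreal_between(1)) (auto simp: zero_less_iff_neq_zero)
      then have "?S - ennreal e < (SUP n. \<Sum>j<n. ?H (R j))"
        by (simp flip: suminf_eq_SUP)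
      then obtain n where "?S - ennreal e < (\<Sum>j<n. ?H (R j))"
        by (auto simp: less_SUP_iff)
      then have "?S \<le> ennreal e + (\<Sum>j<n. ?H (R j))"
        using sum_fin by (auto simp: ennreal_minus_le_iff dest!: less_imp_le)
      then show ?thesis by blast
    qed (use \<open>0 < e\<close> in auto)
    then obtain n where n: "?S \<le> ennreal e + (\<Sum>j<n. ?H (R j))"
      by blast
    have S_eq: "?S = (\<Sum>j<n. ?H (R j)) + (\<Sum>j. ?H (R (j + n)))"
      using suminf_offset[of "\<lambda>j. ?H (R j)" n] by (simp add: add.commute)
    have tail: "(\<Sum>j. ?H (R (j + n))) \<le> ennreal e"
    proof -
      have "(\<Sum>j<n. ?H (R j)) + (\<Sum>j. ?H (R (j + n))) \<le> (\<Sum>j<n. ?H (R j)) + ennreal e"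
        using n S_eq by (simp add: add.commute)
      moreover have "(\<Sum>j<n. ?H (R j)) \<noteq> \<infinity>"
        using sum_fin S_eq by (metis infinity_ennreal_def ennreal_add_eq_top less_irrefl)
      ultimately show ?thesis
        by (simp only: ennreal_add_left_cancel_le) blast
    qed
    have "T - C \<subseteq> A n \<union> (\<Union>j. R (j + n))"
    proof
      fix x assume x: "x \<in> T - C"
      then have "0 < infdist x C"
        using infdist_pos_not_in_closed \<open>closed C\<close> \<open>C \<noteq> {}\<close> by auto
      then obtain N where "inverse (real (Suc N)) < infdist x C"
        using reals_Archimedean by blast
      then have ex: "x \<in> A N"
        using x by (auto simp: A_def inverse_eq_divide)
      define L where "L = (LEAST N. x \<in> A N)"
      have L: "x \<in> A L" and L_min: "\<And>j. j < L \<Longrightarrow> x \<notin> A j"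
        unfolding L_def using ex by (auto intro: LeastI dest: not_less_Least)
      show "x \<in> A n \<union> (\<Union>j. R (j + n))"
      proof (cases "L \<le> n")
        case True
        then show ?thesis using A_mono L by blast
      next
        case False
        then obtain j where "L = Suc (j + n)"
          by (metis less_iff_Suc_add not_le add.commute add_Suc_right)
        then have "x \<in> R (j + n)"
          using L L_min by (auto simp: R_def)
        then show ?thesis by blast
      qed
    qed
    then have "?H (T - C) \<le> ?H (A n \<union> (\<Union>j. R (j + n)))"
      by (rule hausdorff_outer_measure_mono)
    also have "\<dots> \<le> ?H (A n) + ?H (\<Union>j. R (j + n))"
      by (rule hausdorff_outer_measure_Un)
    also have "\<dots> \<le> ?H (A n) + ennreal e"
      by (intro add_left_mono order_trans[OF hausdorff_outer_measure_UN tail])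
    finally have "?H (T \<inter> C) + ?H (T - C) \<le> (?H (T \<inter> C) + ?H (A n)) + ennreal e"
      by (simp add: add.assoc add_left_mono)
    also have "\<dots> \<le> ?H T + ennreal e"
      by (intro add_right_mono near)
    finally show "?H (T \<inter> C) + ?H (T - C) \<le> ?H T + ennreal e" .
  qed
qed

lemma measure_space_hausdorff:
  "measure_space UNIV (sets borel) (hausdorff_outer_measure k :: 'a::metric_space set \<Rightarrow> ennreal)"
proof -
  let ?H = "hausdorff_outer_measure k :: 'a set \<Rightarrow> ennreal"
  let ?L = "lambda_system UNIV (Pow UNIV) ?H"
  interpret P: sigma_algebra UNIV "Pow UNIV :: 'a set set"
    by (rule sigma_algebra_Pow)
  have L: "measure_space UNIV ?L ?H"
    by (rule P.caratheodory_lemma[OF outer_measure_space_hausdorff])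
  then interpret L: sigma_algebra UNIV ?L
    by (simp add: measure_space_def)
  have closed: "C \<in> ?L" if "closed C" for C
    unfolding P.lambda_system_eq
  proof (intro CollectI conjI ballI antisym)
    fix T
    show "?H (T \<inter> C) + ?H (T - C) \<le> ?H T"
      by (rule closed_hausdorff_caratheodory[OF that])
    show "?H T \<le> ?H (T \<inter> C) + ?H (T - C)"
      using hausdorff_outer_measure_Un[of k "T \<inter> C" "T - C"] by (simp add: Int_Diff_Un)
  qed simp
  have "U \<in> ?L" if "open U" for U
    using L.compl_sets[OF closed[of "- U"]] that by (simp add: closed_def Compl_eq_Diff_UNIV[symmetric])
  then have "sets borel \<subseteq> ?L"
    unfolding sets_borel by (intro L.sigma_sets_subset) auto
  then show ?thesis
    using L sets.sigma_algebra_axioms[of "borel :: 'a measure"]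
    by (auto simp: measure_space_def positive_def countably_additive_def)
qed

lemma emeasure_hausdorff_measure:
  assumes "A \<in> sets borel"
  shows "emeasure (hausdorff_measure k) A = hausdorff_outer_measure k A"
  unfolding hausdorff_measure_def
  using measure_space_hausdorff[of k] assms
  by (intro emeasure_measure_of_sigma) (auto simp: measure_space_def)


section \<open>Weighted perimeter of convex bodies\<close>

definition convex_body :: "(real ^ 'n) set \<Rightarrow> bool" where
  "convex_body E \<longleftrightarrow> compact E \<and> convex E \<and> interior E \<noteq> {}"

definition locally_integrable :: "(real ^ 'n \<Rightarrow> ennreal) \<Rightarrow> bool" where
  "locally_integrable f \<longleftrightarrow>
     f \<in> borel_measurable lebesgue \<and> (\<forall>K. compact K \<longrightarrow> (\<integral>\<^sup>+x\<in>K. f x \<partial>lebesgue) < \<infinity>)"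

definition weighted_perimeter :: "(real ^ 'n \<Rightarrow> ennreal) \<Rightarrow> (real ^ 'n) set \<Rightarrow> ennreal" where
  "weighted_perimeter f E = (\<integral>\<^sup>+x\<in>frontier E. f x \<partial>hausdorff_measure (CARD('n) - 1))"

end

theory Submission
  imports Defs
begin

text \<open>
  The idea is to test the hypothesis on a convex body \<open>A\<close> with a flat face and on the body \<open>B\<close> obtained
  from it by raising a very low roof over that face. Let \<open>A\<close> be a cylinder with axis \<open>u\<close> whose
  top face is the disc \<open>D\<close> of radius \<open>r\<close> in the hyperplane orthogonal to \<open>u\<close>, and let \<open>B\<close> be
  \<open>A\<close> together with the cone of height \<open>t * r\<close> over \<open>D\<close>. The two boundaries
  differ only in that \<open>D\<close> is replaced by the graph of \<open>t * (r - norm x)\<close> over \<open>D\<close>, so \<open>P(A) \<le> P(B)\<close> says that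
  the integral of \<open>f\<close> over \<open>D\<close> is at most its integral over the graph. The graph map stretches
  distances by at most \<open>1 + t\<^sup>2\<close>. This costs only a second-order error in \<open>t\<close>, whereas moving \<open>f\<close>
  upwards by \<open>t * (r - norm x)\<close> changes it to first order. Letting \<open>t\<close> tend to \<open>0\<close> shows that \<open>f\<close> cannot
  decrease to first order in the direction \<open>u\<close> (\<open>roof_inequality\<close>, \<open>perimeter_monotone_no_decrease\<close>).
  The same holds for \<open>-u\<close>, so \<open>f\<close> must be constant along \<open>u\<close>.

  For this, \<open>f\<close> has to be regular. The hypothesis is invariant under translations and linear in \<open>f\<close>, so
  by Tonelli's theorem it passes from \<open>f\<close> to every average of its translates
  (\<open>perimeter_monotone_average\<close>). Averaging over a box gives the function \<open>g\<close>, which is continuous.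
  Averaging \<open>g\<close> once more over the translations by \<open>s *\<^sub>R u\<close> with \<open>0 \<le> s \<le> \<rho>\<close> gives a
  function whose derivative in the direction \<open>u\<close> is the difference of the two values of \<open>g\<close> at distance
  \<open>\<rho>\<close>. Hence \<open>g\<close> takes the same value at any two points whose difference is parallel to an axis, so \<open>g\<close>
  is constant. As this holds for every box, the measure with density \<open>f\<close> is a multiple of
  Lebesgue measure on boxes, and therefore \<open>f\<close> is constant almost everywhere.

  About Hausdorff measure the argument uses three facts: a Lipschitz map with constant \<open>L\<close> enlarges it at most by
  the factor \<open>L ^ k\<close>, it is finite on boundaries of convex bodies, and it is positive on
  flat discs orthogonal to a coordinate axis.
\<close>

section \<open>Hausdorff measure and Lipschitz maps\<close>

lemma hausdorff_gauge_lipschitz_image: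
  fixes h :: "'a::metric_space \<Rightarrow> 'b::real_normed_vector"
  assumes "bounded C" "0 < L" "\<And>x y. x \<in> C \<Longrightarrow> y \<in> C \<Longrightarrow> dist (h x) (h y) \<le> L * dist x y"
  shows "bounded (h ` C)" "diameter (h ` C) \<le> L * diameter C"
    "hausdorff_gauge k (h ` C) \<le> ennreal (L ^ k) * hausdorff_gauge k C"
proof -
  have d: "dist (h x) (h y) \<le> L * diameter C" if "x \<in> C" "y \<in> C" for x y
    using assms(3)[OF that] diameter_bounded_bound[OF assms(1) that] \<open>0 < L\<close>
    by (meson mult_left_mono order_trans less_imp_le)
  have nn: "0 \<le> diameter C"
    using assms(1) by (rule diameter_ge_0)
  show b: "bounded (h ` C)"
    using d by (intro bounded_two_points[THEN iffD2]) blast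
  show e: "diameter (h ` C) \<le> L * diameter C"
    using d nn \<open>0 < L\<close> by (intro diameter_le) (auto simp: dist_norm)
  show "hausdorff_gauge k (h ` C) \<le> ennreal (L ^ k) * hausdorff_gauge k C"
  proof (cases "C = {}")
    case False
    have "(diameter (h ` C) / 2) ^ k \<le> (L * diameter C / 2) ^ k"
      using e diameter_ge_0[OF b] by (intro power_mono) auto
    also have "\<dots> = L ^ k * (diameter C / 2) ^ k"
      by (simp add: power_mult_distrib power_divide)
    finally have "unit_ball_vol (real k) * (diameter (h ` C) / 2) ^ k
        \<le> L ^ k * (unit_ball_vol (real k) * (diameter C / 2) ^ k)"
      by (simp add: mult_left_mono mult.left_commute)
    then show ?thesis
      using False nn \<open>0 < L\<close>
      by (auto simp: hausdorff_gauge_def ennreal_mult[symmetric] intro!: ennreal_leI)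
  qed auto
qed

lemma hausdorff_outer_measure_lipschitz_image:
  fixes h :: "'a::metric_space \<Rightarrow> 'b::real_normed_vector"
  assumes "0 < L" "\<And>x y. x \<in> S \<Longrightarrow> y \<in> S \<Longrightarrow> dist (h x) (h y) \<le> L * dist x y"
  shows "hausdorff_outer_measure k (h ` S) \<le> ennreal (L ^ k) * hausdorff_outer_measure k S"
  unfolding hausdorff_outer_measure_def[of k "h ` S"]
proof (rule SUP_least)
  fix \<delta> :: real assume "\<delta> \<in> {0<..}"
  then have "0 < \<delta> / L"
    using \<open>0 < L\<close> by simp
  have Lk: "0 < ennreal (L ^ k)"
    using \<open>0 < L\<close> by simp
  have "hausdorff_premeasure k \<delta> (h ` S) / ennreal (L ^ k) \<le> hausdorff_premeasure k (\<delta> / L) S"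
    unfolding hausdorff_premeasure_def[of k "\<delta> / L"]
  proof (rule INF_greatest)
    fix C assume "C \<in> {C :: nat \<Rightarrow> 'a set. S \<subseteq> (\<Union>i. C i) \<and> (\<forall>i. bounded (C i) \<and> diameter (C i) \<le> \<delta> / L)}"
    then have C: "S \<subseteq> (\<Union>i. C i)" "\<And>i. bounded (C i)" "\<And>i. diameter (C i) \<le> \<delta> / L"
      by auto
    have b: "bounded (C i \<inter> S)" for i
      using C(2) by (auto intro: bounded_subset)
    note lip = hausdorff_gauge_lipschitz_image[OF b \<open>0 < L\<close>, of _ h]
    have "hausdorff_premeasure k \<delta> (h ` S) \<le> (\<Sum>i. hausdorff_gauge k (h ` (C i \<inter> S)))"
    proof (rule hausdorff_premeasure_le)
      show "h ` S \<subseteq> (\<Union>i. h ` (C i \<inter> S))"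
        using C(1) by blast
      show "bounded (h ` (C i \<inter> S))" for i
        by (rule lip) (auto intro: assms)
      have "diameter (h ` (C i \<inter> S)) \<le> L * diameter (C i \<inter> S)" for i
        by (rule lip) (auto intro: assms)
      also have "\<dots> i \<le> L * (\<delta> / L)" for i
        using C(3)[of i] diameter_subset[OF _ C(2), of "C i \<inter> S" i] \<open>0 < L\<close>
        by (intro mult_left_mono) auto
      finally show "diameter (h ` (C i \<inter> S)) \<le> \<delta>" for i
        using \<open>0 < L\<close> by simp
    qed
    also have "\<dots> \<le> (\<Sum>i. ennreal (L ^ k) * hausdorff_gauge k (C i))"
    proof (intro suminf_le)
      fix i
      have "hausdorff_gauge k (h ` (C i \<inter> S)) \<le> ennreal (L ^ k) * hausdorff_gauge k (C i \<inter> S)"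
        by (rule lip) (auto intro: assms)
      also have "\<dots> \<le> ennreal (L ^ k) * hausdorff_gauge k (C i)"
        using C(2) by (intro mult_left_mono hausdorff_gauge_mono) auto
      finally show "hausdorff_gauge k (h ` (C i \<inter> S)) \<le> ennreal (L ^ k) * hausdorff_gauge k (C i)" .
    qed auto
    finally show "hausdorff_premeasure k \<delta> (h ` S) / ennreal (L ^ k) \<le> (\<Sum>i. hausdorff_gauge k (C i))"
      using Lk by (intro divide_le_posI_ennreal) auto
  qed
  also have "\<dots> \<le> hausdorff_outer_measure k S"
    using \<open>0 < \<delta> / L\<close> by (rule hausdorff_premeasure_le_outer)
  finally have "hausdorff_premeasure k \<delta> (h ` S) / ennreal (L ^ k) * ennreal (L ^ k)
      \<le> hausdorff_outer_measure k S * ennreal (L ^ k)"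
    by (rule mult_right_mono) simp
  moreover have "hausdorff_premeasure k \<delta> (h ` S) / ennreal (L ^ k) * ennreal (L ^ k)
      = hausdorff_premeasure k \<delta> (h ` S)"
  proof -
    have "ennreal (L ^ k) / ennreal (L ^ k) = 1"
      using \<open>0 < L\<close> by (intro ennreal_divide_self) (auto simp: ennreal_eq_0_iff not_le)
    then show ?thesis by (simp only: ennreal_divide_times mult_1_right)
  qed
  ultimately show "hausdorff_premeasure k \<delta> (h ` S) \<le> ennreal (L ^ k) * hausdorff_outer_measure k S"
    by (simp add: mult.commute)
qed

text \<open>
  A one-sided substitute for the change of variables formula. With \<open>L = 1\<close> and a translation and its inverse,
  it gives the translation invariance of the measure; for the graph of a function it bounds the
  surface integral.
\<close>

lemma nn_integral_hausdorff_lipschitz: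
  fixes h :: "'a::real_normed_vector \<Rightarrow> 'a" and F :: "'a \<Rightarrow> ennreal"
  assumes L: "0 < L" "\<And>x y. x \<in> S \<Longrightarrow> y \<in> S \<Longrightarrow> dist (h x) (h y) \<le> L * dist x y"
    and [measurable]: "h \<in> borel_measurable borel" "S \<in> sets borel" "T \<in> sets borel" "F \<in> borel_measurable borel"
    and T: "T \<subseteq> h ` S"
  shows "(\<integral>\<^sup>+x\<in>T. F x \<partial>hausdorff_measure k) \<le> ennreal (L ^ k) * (\<integral>\<^sup>+x\<in>S. F (h x) \<partial>hausdorff_measure k)"
proof -
  let ?H = "hausdorff_measure k :: 'a measure"
  let ?M = "density ?H (indicator T)" and ?N = "density ?H (indicator S)"
  \<comment> \<open>On \<open>T\<close> the measure is dominated by the image of its restriction to \<open>S\<close> under \<open>h\<close>, scaled by \<open>L ^ k\<close>.\<close>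
  let ?R = "scale_measure (ennreal (L ^ k)) (distr ?N borel h)"
  have le: "emeasure ?M X \<le> emeasure ?R X" if X [measurable]: "X \<in> sets borel" for X
  proof -
    have "h -` X \<inter> space borel \<in> sets borel" by measurable
    then have Y [measurable]: "h -` X \<in> sets borel" by simp
    have "emeasure ?M X = hausdorff_outer_measure k (T \<inter> X)"
      by (simp add: emeasure_density emeasure_hausdorff_measure
          flip: indicator_inter_arith)
    also have "\<dots> \<le> hausdorff_outer_measure k (h ` (S \<inter> h -` X))"
      using T by (intro hausdorff_outer_measure_mono) auto
    also have "\<dots> \<le> ennreal (L ^ k) * hausdorff_outer_measure k (S \<inter> h -` X)"
      by (intro hausdorff_outer_measure_lipschitz_image L) auto
    also have "hausdorff_outer_measure k (S \<inter> h -` X) = emeasure ?N (h -` X)"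
      by (simp add: emeasure_density emeasure_hausdorff_measure
          flip: indicator_inter_arith)
    also have "ennreal (L ^ k) * emeasure ?N (h -` X) = emeasure ?R X"
      by (simp add: emeasure_distr)
    finally show ?thesis .
  qed
  have "emeasure ?M X \<le> emeasure ?R X" for X
    using le[of X] by (cases "X \<in> sets borel") (auto simp: emeasure_notin_sets)
  then have "?M \<le> ?R"
    by (simp add: le_measure_iff le_fun_def space_scale_measure)
  then have "nn_integral ?M F \<le> nn_integral ?R F"
    by (intro nn_integral_mono_measure) auto
  then show ?thesis
    by (simp add: nn_integral_scale_measure nn_integral_distr nn_integral_density mult.commute)
qed

section \<open>Surfaces of finite and positive measure\<close>

lemma hausdorff_premeasure_le_finite_cover:
  fixes S :: "'a::metric_space set"
  assumes "finite \<C>" "S \<subseteq> \<Union>\<C>" "\<And>C. C \<in> \<C> \<Longrightarrow> bounded C" "\<And>C. C \<in> \<C> \<Longrightarrow> diameter C \<le> d" "0 \<le> d" "d \<le> \<delta>"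
  shows "hausdorff_premeasure k \<delta> S \<le> of_nat (card \<C>) * ennreal (unit_ball_vol (real k) * (d / 2) ^ k)"
proof -
  obtain e where e: "bij_betw e {..<card \<C>} \<C>"
    using ex_bij_betw_nat_finite[OF assms(1)] by (auto simp: atLeast0LessThan)
  define C where "C i = (if i < card \<C> then e i else {})" for i
  have in_C: "e i \<in> \<C>" if "i < card \<C>" for i
    using e that by (auto simp: bij_betw_def)
  have gauge: "hausdorff_gauge k (C i) \<le> ennreal (unit_ball_vol (real k) * (d / 2) ^ k)" for i
    using assms(3,4)[OF in_C] diameter_ge_0[OF assms(3)[OF in_C]]
    by (auto simp: C_def hausdorff_gauge_def intro!: ennreal_leI mult_left_mono power_mono divide_right_mono)
  have "S \<subseteq> (\<Union>i. C i)"
  proof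
    fix x assume "x \<in> S"
    then obtain D where "x \<in> D" "D \<in> \<C>" using assms(2) by auto
    moreover have "D \<in> e ` {..<card \<C>}"
      using e \<open>D \<in> \<C>\<close> by (simp add: bij_betw_def)
    then obtain i where "i < card \<C>" "e i = D"
      by auto
    ultimately show "x \<in> (\<Union>i. C i)"
      by (auto simp: C_def intro!: exI[of _ i])
  qed
  then have "hausdorff_premeasure k \<delta> S \<le> (\<Sum>i. hausdorff_gauge k (C i))"
    using assms(3,4)[OF in_C] assms(5,6)
    by (intro hausdorff_premeasure_le) (auto simp: C_def intro: order_trans)
  also have "\<dots> = (\<Sum>i<card \<C>. hausdorff_gauge k (C i))"
    by (intro suminf_finite) (auto simp: C_def)
  also have "\<dots> \<le> (\<Sum>i<card \<C>. ennreal (unit_ball_vol (real k) * (d / 2) ^ k))"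
    by (intro sum_mono gauge)
  finally show ?thesis by simp
qed

text \<open>
  The flat piece is covered by about \<open>n ^ m\<close> cubes with side \<open>2 * r / n\<close>, where \<open>m\<close> is its dimension. Their gauges
  add up to a bound that does not depend on \<open>n\<close>.
\<close>

lemma hausdorff_flat_finite:
  fixes u :: "'a::euclidean_space"
  assumes "u \<in> Basis"
  shows "hausdorff_outer_measure (DIM('a) - 1) {x. x \<bullet> u = c \<and> (\<forall>b\<in>Basis. \<bar>x \<bullet> b\<bar> \<le> R)} < \<infinity>"
    (is "hausdorff_outer_measure ?m ?S < \<infinity>")
proof -
  define N where "N = real DIM('a)"
  define r where "r = max 1 R"
  let ?B = "Basis - {u} :: 'a set"
  have N: "0 < N" and r: "0 < r" "R \<le> r"
    by (auto simp: N_def r_def)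
  define K where "K = unit_ball_vol (real ?m) * (2 * N * r) ^ ?m"
  have "hausdorff_premeasure ?m \<delta> ?S \<le> ennreal K" if "0 < \<delta>" for \<delta>
  proof -
    obtain n :: nat where n: "2 * N * r / \<delta> < real n"
      using reals_Archimedean2 by blast
    have "0 < 2 * N * r / \<delta>" using N r \<open>0 < \<delta>\<close> by simp
    with n have n0: "0 < n" by (cases n) auto
    define d where "d = 2 * N * r / n"
    have d: "0 \<le> d" "d \<le> \<delta>"
      using n n0 N r \<open>0 < \<delta>\<close> by (auto simp: d_def field_simps)
    define C where "C p = {x. x \<bullet> u = c \<and> (\<forall>b\<in>?B. - r + 2 * r * real (p b) / n \<le> x \<bullet> b \<and>
       x \<bullet> b \<le> - r + 2 * r * (real (p b) + 1) / n)}" for p :: "'a \<Rightarrow> nat"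
    \<comment> \<open>The last cell in each direction, with index \<open>n\<close>, only serves to catch \<open>x \<bullet> b = r\<close>; hence
      \<open>n + 1\<close> cells per direction.\<close>
    define P where "P = (?B \<rightarrow>\<^sub>E {..n})"
    have "finite P" and cardP: "card P = (n + 1) ^ ?m"
      using assms by (auto simp: P_def card_PiE card_Diff_singleton intro!: finite_PiE)
    have close: "norm (x - y) \<le> d" if "x \<in> C p" "y \<in> C p" for x y p
    proof -
      have "norm (x - y) \<le> (\<Sum>b\<in>Basis. \<bar>(x - y) \<bullet> b\<bar>)"
        by (rule norm_le_l1)
      also have "\<dots> \<le> (\<Sum>b\<in>(Basis::'a set). 2 * r / n)"
      proof (rule sum_mono)
        fix b :: 'a assume "b \<in> Basis"
        show "\<bar>(x - y) \<bullet> b\<bar> \<le> 2 * r / n"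
        proof (cases "b = u")
          case True
          then show ?thesis using that r by (simp add: C_def inner_diff_left)
        next
          case False
          then have "- r + 2 * r * real (p b) / n \<le> x \<bullet> b" "x \<bullet> b \<le> - r + 2 * r * (real (p b) + 1) / n"
            "- r + 2 * r * real (p b) / n \<le> y \<bullet> b" "y \<bullet> b \<le> - r + 2 * r * (real (p b) + 1) / n"
            using that \<open>b \<in> Basis\<close> by (auto simp: C_def)
          moreover have "2 * r * (real (p b) + 1) / n = 2 * r * real (p b) / n + 2 * r / n"
            by (simp add: add_divide_distrib distrib_left)
          ultimately show ?thesis unfolding inner_diff_left abs_le_iff by linarith
        qed
      qed
      also have "\<dots> = d" by (simp add: d_def N_def)
      finally show ?thesis .
    qed
    have bdd: "bounded (C p)" for p
      using close by (auto simp: bounded_two_points dist_norm)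
    have diam: "diameter (C p) \<le> d" for p
      using close d(1) by (intro diameter_le) auto
    have cover: "?S \<subseteq> \<Union>(C ` P)"
    proof
      fix x assume x: "x \<in> ?S"
      define p where "p = (\<lambda>b\<in>?B. nat \<lfloor>(x \<bullet> b + r) * n / (2 * r)\<rfloor>)"
      have "0 \<le> (x \<bullet> b + r) * n / (2 * r) \<and> (x \<bullet> b + r) * n / (2 * r) \<le> n" if "b \<in> ?B" for b
      proof -
        have "\<bar>x \<bullet> b\<bar> \<le> r" using x that r(2) by auto
        then have "0 \<le> x \<bullet> b + r" "x \<bullet> b + r \<le> 2 * r" by linarith+
        then show ?thesis using r n0 by (auto simp: divide_le_eq mult.commute mult_right_mono)
      qed
      then have z: "0 \<le> (x \<bullet> b + r) * n / (2 * r)" "(x \<bullet> b + r) * n / (2 * r) \<le> n" if "b \<in> ?B" for b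
        using that by blast+
      have fl: "real (p b) \<le> (x \<bullet> b + r) * n / (2 * r)" "(x \<bullet> b + r) * n / (2 * r) < real (p b) + 1"
           "p b \<le> n" if "b \<in> ?B" for b
      proof -
        let ?z = "(x \<bullet> b + r) * n / (2 * r)"
        have pb: "p b = nat \<lfloor>?z\<rfloor>" using that by (simp add: p_def)
        have z: "0 \<le> ?z" "?z \<le> n" using z that by blast+
        have "0 \<le> \<lfloor>?z\<rfloor>" "\<lfloor>?z\<rfloor> \<le> int n" using z by (simp_all add: floor_le_iff)
        then show "real (p b) \<le> ?z" "?z < real (p b) + 1" "p b \<le> n"
          unfolding pb by (simp_all add: nat_le_iff)
      qed
      have "- r + 2 * r * real (p b) / n \<le> x \<bullet> b" "x \<bullet> b \<le> - r + 2 * r * (real (p b) + 1) / n" if "b \<in> ?B" for b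
      proof -
        let ?z = "(x \<bullet> b + r) * n / (2 * r)"
        have "2 * r * ?z / n = x \<bullet> b + r"
          using r n0 by simp
        moreover have "2 * r * real (p b) / n \<le> 2 * r * ?z / n" "2 * r * ?z / n \<le> 2 * r * (real (p b) + 1) / n"
          using fl[OF that] r by (intro divide_right_mono mult_left_mono; simp)+
        ultimately show "- r + 2 * r * real (p b) / n \<le> x \<bullet> b" "x \<bullet> b \<le> - r + 2 * r * (real (p b) + 1) / n"
          by linarith+
      qed
      then have "x \<in> C p"
        using x by (simp add: C_def)
      moreover have "p \<in> P"
        using fl(3) by (auto simp: P_def p_def)
      ultimately show "x \<in> \<Union>(C ` P)" by blast
    qed
    have "hausdorff_premeasure ?m \<delta> ?S \<le> of_nat (card (C ` P)) * ennreal (unit_ball_vol (real ?m) * (d / 2) ^ ?m)"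
      using \<open>finite P\<close> cover bdd diam d by (intro hausdorff_premeasure_le_finite_cover) auto
    also have "\<dots> \<le> of_nat ((n + 1) ^ ?m) * ennreal (unit_ball_vol (real ?m) * (d / 2) ^ ?m)"
      using card_image_le[OF \<open>finite P\<close>, of C] cardP by (intro mult_right_mono of_nat_mono) auto
    also have "\<dots> = ennreal (unit_ball_vol (real ?m) * ((real n + 1) * (d / 2)) ^ ?m)"
    proof -
      have "real ((n + 1) ^ ?m) * (unit_ball_vol (real ?m) * (d / 2) ^ ?m)
          = unit_ball_vol (real ?m) * ((real n + 1) * (d / 2)) ^ ?m"
        unfolding power_mult_distrib by (simp add: add.commute)
      then show ?thesis
        using d by (simp only: ennreal_of_nat_eq_real_of_nat flip: ennreal_mult) (subst ennreal_mult[symmetric], auto)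
    qed
    also have "\<dots> \<le> ennreal K"
    proof -
      have "(real n + 1) * (d / 2) \<le> (2 * real n) * (d / 2)"
        using n0 d by (intro mult_right_mono) auto
      also have "\<dots> = 2 * N * r" using n0 by (simp add: d_def)
      finally show ?thesis
        unfolding K_def using d by (intro ennreal_leI mult_left_mono power_mono) auto
    qed
    finally show ?thesis .
  qed
  then have "hausdorff_outer_measure ?m ?S \<le> ennreal K"
    unfolding hausdorff_outer_measure_def by (intro SUP_least) auto
  then show ?thesis
    by (rule order.strict_trans1) simp
qed

lemma hausdorff_outer_measure_finite_UN:
  assumes "finite I" "\<And>i. i \<in> I \<Longrightarrow> hausdorff_outer_measure k (A i) < \<infinity>"
  shows "hausdorff_outer_measure k (\<Union>i\<in>I. A i) < \<infinity>"
  using assms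
proof (induction I)
  case (insert i I)
  then have "hausdorff_outer_measure k (A i) + hausdorff_outer_measure k (\<Union>i\<in>I. A i) < \<infinity>"
    by simp
  then show ?case
    using hausdorff_outer_measure_Un[of k "A i" "\<Union>i\<in>I. A i"] by (simp add: order.strict_trans1)
qed simp

lemma hausdorff_frontier_box_finite:
  "hausdorff_outer_measure (DIM('a::euclidean_space) - 1) (frontier (cbox l h :: 'a set)) < \<infinity>"
proof -
  define R where "R = (\<Sum>b\<in>Basis. \<bar>l \<bullet> b\<bar> + \<bar>h \<bullet> b\<bar>)"
  let ?S = "\<lambda>(u::'a, a). {x. x \<bullet> u = a \<bullet> u \<and> (\<forall>b\<in>Basis. \<bar>x \<bullet> b\<bar> \<le> R)}"
  have R: "\<bar>l \<bullet> b\<bar> + \<bar>h \<bullet> b\<bar> \<le> R" if "b \<in> Basis" for b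
    using member_le_sum[of b Basis "\<lambda>b. \<bar>l \<bullet> b\<bar> + \<bar>h \<bullet> b\<bar>"] that by (simp add: R_def)
  have "frontier (cbox l h) \<subseteq> (\<Union>i\<in>Basis \<times> {l, h}. ?S i)"
  proof
    fix x assume "x \<in> frontier (cbox l h)"
    then have x: "\<forall>b\<in>Basis. l \<bullet> b \<le> x \<bullet> b \<and> x \<bullet> b \<le> h \<bullet> b" "x \<notin> box l h"
      by (auto simp: frontier_cbox mem_box)
    then obtain u where u: "u \<in> Basis" "x \<bullet> u = l \<bullet> u \<or> x \<bullet> u = h \<bullet> u"
      by (force simp: mem_box)
    have "\<bar>x \<bullet> b\<bar> \<le> R" if "b \<in> Basis" for b
      using R[OF that] x(1) that by force
    with u show "x \<in> (\<Union>i\<in>Basis \<times> {l, h}. ?S i)"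
      by auto
  qed
  moreover have "hausdorff_outer_measure (DIM('a) - 1) (\<Union>i\<in>Basis \<times> {l, h}. ?S i) < \<infinity>"
  proof (rule hausdorff_outer_measure_finite_UN)
    fix i :: "'a \<times> 'a" assume "i \<in> Basis \<times> {l, h}"
    then show "hausdorff_outer_measure (DIM('a) - 1) (?S i) < \<infinity>"
      using hausdorff_flat_finite[of "fst i" "snd i \<bullet> fst i" R] by (simp add: case_prod_unfold mem_Times_iff)
  qed simp
  ultimately show ?thesis
    by (meson hausdorff_outer_measure_mono order.strict_trans1)
qed

text \<open>
  The nearest-point map onto \<open>E\<close> is 1-Lipschitz and maps the boundary of a large box onto a superset of
  the boundary of \<open>E\<close>: from a boundary point one follows an outer normal until it meets the boundary
  of the box.
\<close>

lemma hausdorff_frontier_convex_finite: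
  fixes E :: "'a::euclidean_space set"
  assumes "compact E" "convex E" "interior E \<noteq> {}"
  shows "hausdorff_outer_measure (DIM('a) - 1) (frontier E) < \<infinity>"
proof -
  obtain a :: 'a where a: "E \<subseteq> box (- a) a"
    using bounded_subset_box_symmetric[OF compact_imp_bounded[OF assms(1)]] by blast
  let ?Q = "cbox (- a) a"
  have E: "closed E" "E \<noteq> {}"
    using assms compact_imp_closed interior_subset by auto
  have "frontier E \<subseteq> closest_point E ` frontier ?Q"
  proof
    fix x assume "x \<in> frontier E"
    then have x: "x \<in> E" "x \<notin> interior E"
      using E(1) by (auto simp: frontier_def)
    then have "x \<notin> rel_interior E"
      using rel_interior_nonempty_interior[OF assms(3)] by simp
    moreover have "x \<in> closure E"
      using x(1) closure_subset by blast
    ultimately obtain v where v: "v \<noteq> 0" "\<And>y. y \<in> closure E \<Longrightarrow> v \<bullet> x \<le> v \<bullet> y"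
      using supporting_hyperplane_relative_frontier[OF assms(2), of x] by metis
    have "x \<in> interior ?Q"
      using a x(1) by auto
    then obtain d where d: "0 < d" "x + d *\<^sub>R (- v) \<in> frontier ?Q"
      using ray_to_frontier[OF bounded_cbox, of x "- a" a "- v"] v(1) by auto
    have "x = closest_point E (x + d *\<^sub>R (- v))"
    proof (rule closest_point_unique[OF assms(2) E(1) x(1)], safe)
      fix z assume "z \<in> E"
      have "0 \<le> v \<bullet> (z - x)"
        using v(2)[of z] \<open>z \<in> E\<close> closure_subset[of E] by (auto simp add: inner_diff_right)
      then have "(d *\<^sub>R v) \<bullet> (d *\<^sub>R v) \<le> (d *\<^sub>R v + (z - x)) \<bullet> (d *\<^sub>R v + (z - x))"
        using d(1) by (simp add: inner_add inner_commute)
      then have "norm (d *\<^sub>R v) \<le> norm (d *\<^sub>R v + (z - x))"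
        by (simp only: norm_le)
      moreover have "dist (x + d *\<^sub>R (- v)) x = norm (d *\<^sub>R v)"
        by (simp add: dist_norm)
      moreover have "dist (x + d *\<^sub>R (- v)) z = norm (d *\<^sub>R v + (z - x))"
        by (simp add: dist_norm norm_minus_commute algebra_simps)
      ultimately show "dist (x + d *\<^sub>R (- v)) x \<le> dist (x + d *\<^sub>R (- v)) z" by simp
    qed
    with d(2) show "x \<in> closest_point E ` frontier ?Q" by blast
  qed
  then have "hausdorff_outer_measure (DIM('a) - 1) (frontier E)
      \<le> hausdorff_outer_measure (DIM('a) - 1) (closest_point E ` frontier ?Q)"
    by (rule hausdorff_outer_measure_mono)
  also have "\<dots> \<le> ennreal (1 ^ (DIM('a) - 1)) * hausdorff_outer_measure (DIM('a) - 1) (frontier ?Q)"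
    using closest_point_lipschitz[OF assms(2) E] by (intro hausdorff_outer_measure_lipschitz_image) auto
  also have "\<dots> < \<infinity>"
    using hausdorff_frontier_box_finite by (simp del: frontier_cbox)
  finally show ?thesis .
qed

text \<open>
  A cover of the disc by small sets becomes, after thickening each set to height 1 in the direction \<open>u\<close>, a
  cover of a cylinder by boxes. The volume of such a box is a constant times the gauge of the
  set, so the gauges cannot add up to less than a multiple of the volume of the cylinder.
\<close>

lemma hausdorff_flat_disc_pos:
  fixes u :: "'a::euclidean_space"
  assumes u: "u \<in> Basis" and "0 < r"
  shows "0 < hausdorff_outer_measure (DIM('a) - 1) {x. x \<bullet> u = 0 \<and> norm x < r}"
    (is "0 < hausdorff_outer_measure ?m ?D")
proof -
  define w where "w = unit_ball_vol (real ?m)"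
  have w: "0 < w" by (simp add: w_def)
  define Q :: "'a set" where "Q = {y. norm (y - (y \<bullet> u) *\<^sub>R u) < r \<and> 0 < y \<bullet> u \<and> y \<bullet> u < 1}"
  have uu: "u \<bullet> u = 1" using u by simp
  have "open Q"
    unfolding Q_def by (intro open_Collect_conj open_Collect_less continuous_intros)
  moreover have "(1 / 2) *\<^sub>R u \<in> Q"
    using \<open>0 < r\<close> by (simp add: Q_def uu)
  ultimately obtain e where e: "0 < e" "ball ((1 / 2) *\<^sub>R u) e \<subseteq> Q"
    by (meson openE)
  have "0 < emeasure lborel (ball ((1 / 2) *\<^sub>R u) e)"
    using e(1) by (simp add: emeasure_ball)
  also have "\<dots> \<le> emeasure lborel Q"
    using e(2) \<open>open Q\<close> by (intro emeasure_mono) auto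
  finally have "0 < emeasure lborel Q" .
  \<comment> \<open>The box has sides \<open>[c \<bullet> b - d, c \<bullet> b + d]\<close> for \<open>b \<noteq> u\<close> and \<open>[0, 1]\<close> in the direction \<open>u\<close>.\<close>
  have box: "emeasure lborel (cbox (c - d *\<^sub>R One + (d - c \<bullet> u) *\<^sub>R u) (c + d *\<^sub>R One + (1 - d - c \<bullet> u) *\<^sub>R u))
      = ennreal ((2 * d) ^ ?m)" (is "emeasure lborel (cbox ?l ?h) = _") if "0 \<le> d" for c :: 'a and d
  proof -
    have side: "(?h - ?l) \<bullet> b = (if b = u then 1 else 2 * d)" if "b \<in> Basis" for b
      using that u by (auto simp: inner_diff_left inner_add_left inner_Basis algebra_simps)
    have "emeasure lborel (cbox ?l ?h) = ennreal (\<Prod>b\<in>Basis. (?h - ?l) \<bullet> b)"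
    proof (rule emeasure_lborel_cbox)
      fix b :: 'a assume "b \<in> Basis"
      then show "?l \<bullet> b \<le> ?h \<bullet> b"
        using side[of b] that unfolding inner_diff_left by (auto split: if_splits)
    qed
    also have "(\<Prod>b\<in>Basis. (?h - ?l) \<bullet> b) = (\<Prod>b\<in>Basis. if b = u then 1 else 2 * d)"
      by (intro prod.cong side) auto
    also have "\<dots> = (2 * d) ^ ?m"
      using u by (simp add: prod.If_cases card_Diff_singleton Diff_eq flip: Diff_eq)
    finally show ?thesis .
  qed
  have "ennreal (w / 4 ^ ?m) * emeasure lborel Q \<le> hausdorff_premeasure ?m 1 ?D"
    unfolding hausdorff_premeasure_def
  proof (rule INF_greatest)
    fix C assume "C \<in> {C :: nat \<Rightarrow> 'a set. ?D \<subseteq> (\<Union>i. C i) \<and> (\<forall>i. bounded (C i) \<and> diameter (C i) \<le> 1)}"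
    then have C: "?D \<subseteq> (\<Union>i. C i)" "\<And>i. bounded (C i)"
      by auto
    define c where "c i = (SOME x. x \<in> C i)" for i
    have c: "c i \<in> C i" if "C i \<noteq> {}" for i
      using that by (auto simp: c_def some_in_eq)
    define d where "d i = diameter (C i)" for i
    have d: "0 \<le> d i" for i
      unfolding d_def by (intro diameter_ge_0 C)
    define K where "K i = (if C i = {} then {} else
      cbox (c i - d i *\<^sub>R One + (d i - c i \<bullet> u) *\<^sub>R u) (c i + d i *\<^sub>R One + (1 - d i - c i \<bullet> u) *\<^sub>R u))" for i
    have "Q \<subseteq> (\<Union>i. K i)"
    proof
      fix y assume y: "y \<in> Q"
      define x where "x = y - (y \<bullet> u) *\<^sub>R u"
      have "x \<in> ?D"
        using y by (simp add: Q_def x_def inner_diff_left uu)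
      then obtain i where i: "x \<in> C i"
        using C(1) by auto
      have le: "\<bar>x \<bullet> b - c i \<bullet> b\<bar> \<le> d i" if "b \<in> Basis" for b
      proof -
        have "\<bar>x \<bullet> b - c i \<bullet> b\<bar> \<le> norm (x - c i)"
          using Basis_le_norm[OF that, of "x - c i"] by (simp add: inner_diff_left)
        also have "\<dots> \<le> d i"
          using diameter_bounded_bound[OF C(2) i c] i by (auto simp: d_def dist_norm)
        finally show ?thesis .
      qed
      have "y \<in> cbox (c i - d i *\<^sub>R One + (d i - c i \<bullet> u) *\<^sub>R u) (c i + d i *\<^sub>R One + (1 - d i - c i \<bullet> u) *\<^sub>R u)"
        unfolding mem_box
      proof
        fix b :: 'a assume b: "b \<in> Basis"
        show "(c i - d i *\<^sub>R One + (d i - c i \<bullet> u) *\<^sub>R u) \<bullet> b \<le> y \<bullet> b \<and>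
              y \<bullet> b \<le> (c i + d i *\<^sub>R One + (1 - d i - c i \<bullet> u) *\<^sub>R u) \<bullet> b"
        proof (cases "b = u")
          case True
          then show ?thesis using y u by (simp add: Q_def inner_diff_left inner_add_left)
        next
          case False
          then have "u \<bullet> b = 0" using u b by (simp add: inner_Basis)
          moreover from this have "x \<bullet> b = y \<bullet> b" by (simp add: x_def inner_diff_left)
          ultimately show ?thesis
            using le[OF b] b by (simp add: inner_diff_left inner_add_left abs_le_iff)
        qed
      qed
      with i show "y \<in> (\<Union>i. K i)" by (auto simp: K_def)
    qed
    then have "emeasure lborel Q \<le> emeasure lborel (\<Union>i. K i)"
      by (intro emeasure_mono) (auto simp: K_def)
    also have "\<dots> \<le> (\<Sum>i. emeasure lborel (K i))"
      by (intro emeasure_subadditive_countably) (auto simp: K_def)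
    finally have "ennreal (w / 4 ^ ?m) * emeasure lborel Q \<le> (\<Sum>i. ennreal (w / 4 ^ ?m) * emeasure lborel (K i))"
      by (simp add: mult_left_mono)
    also have "\<dots> = (\<Sum>i. hausdorff_gauge ?m (C i))"
    proof (rule suminf_cong)
      fix i
      have "(2 * d i) ^ ?m = 4 ^ ?m * (d i / 2) ^ ?m"
        using power_mult_distrib[of 4 "d i / 2" ?m] by simp
      then have "w / 4 ^ ?m * (2 * d i) ^ ?m = w * (d i / 2) ^ ?m"
        by simp
      moreover have "hausdorff_gauge ?m (C i) = (if C i = {} then 0 else ennreal (w * (d i / 2) ^ ?m))"
        by (simp add: hausdorff_gauge_def w_def d_def)
      moreover have "emeasure lborel (K i) = (if C i = {} then 0 else ennreal ((2 * d i) ^ ?m))"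
        using box[OF d] by (simp add: K_def)
      ultimately show "ennreal (w / 4 ^ ?m) * emeasure lborel (K i) = hausdorff_gauge ?m (C i)"
        using w by (simp flip: ennreal_mult')
    qed
    finally show "ennreal (w / 4 ^ ?m) * emeasure lborel Q \<le> (\<Sum>i. hausdorff_gauge ?m (C i))" .
  qed
  moreover have "0 < ennreal (w / 4 ^ ?m) * emeasure lborel Q"
    using w \<open>0 < emeasure lborel Q\<close> by (simp add: ennreal_zero_less_mult_iff)
  ultimately show ?thesis
    using hausdorff_premeasure_le_outer[of 1 ?m ?D] by (auto intro: order.strict_trans2)
qed

section \<open>Averaging over translations\<close>

definition perimeter_monotone :: "(real ^ 'n \<Rightarrow> ennreal) \<Rightarrow> bool" where
  "perimeter_monotone f \<longleftrightarrow> f \<in> borel_measurable borel \<and>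
     (\<forall>A B. convex_body A \<longrightarrow> convex_body B \<longrightarrow> A \<subseteq> B \<longrightarrow>
        weighted_perimeter f A \<le> weighted_perimeter f B)"

lemma perimeter_monotoneD:
  "perimeter_monotone f \<Longrightarrow> convex_body A \<Longrightarrow> convex_body B \<Longrightarrow> A \<subseteq> B \<Longrightarrow>
    weighted_perimeter f A \<le> weighted_perimeter f B"
  by (simp add: perimeter_monotone_def)

lemma convex_body_translation: "convex_body E \<Longrightarrow> convex_body ((+) v ` E)"
  unfolding convex_body_def
  using compact_translation[of E v] convex_translation[of E v] interior_translation[of v E]
  by simp

lemma weighted_perimeter_translation:
  fixes f :: "real ^ 'n \<Rightarrow> ennreal"
  assumes [measurable]: "f \<in> borel_measurable borel"
  shows "weighted_perimeter f ((+) v ` E) = weighted_perimeter (\<lambda>x. f (v + x)) E"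
proof (rule antisym)
  let ?m = "CARD('n) - 1"
  have meas [measurable]: "frontier S \<in> sets borel" for S :: "(real ^ 'n) set"
    by (simp add: borel_closed)
  have "(\<integral>\<^sup>+x\<in>frontier ((+) v ` E). f x \<partial>hausdorff_measure ?m)
      \<le> ennreal (1 ^ ?m) * (\<integral>\<^sup>+x\<in>frontier E. f (v + x) \<partial>hausdorff_measure ?m)"
    by (rule nn_integral_hausdorff_lipschitz) (auto simp: frontier_translation intro!: borel_closed closed_translation)
  then show "weighted_perimeter f ((+) v ` E) \<le> weighted_perimeter (\<lambda>x. f (v + x)) E"
    by (simp add: weighted_perimeter_def)
  have "(\<integral>\<^sup>+x\<in>frontier E. f (v + x) \<partial>hausdorff_measure ?m)
      \<le> ennreal (1 ^ ?m) * (\<integral>\<^sup>+x\<in>frontier ((+) v ` E). f (v + (x - v)) \<partial>hausdorff_measure ?m)"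
    by (rule nn_integral_hausdorff_lipschitz[where h = "\<lambda>x. x - v"])
      (auto simp: frontier_translation dist_norm image_image intro!: borel_closed closed_translation)
  then show "weighted_perimeter (\<lambda>x. f (v + x)) E \<le> weighted_perimeter f ((+) v ` E)"
    by (simp add: weighted_perimeter_def)
qed

text \<open>
  Tonelli's theorem applies because the Hausdorff measure on the boundary of \<open>E\<close> is finite. Averaging the
  weight over translations then amounts to averaging over translated bodies.
\<close>

lemma weighted_perimeter_average:
  fixes f :: "real ^ 'n \<Rightarrow> ennreal"
  assumes M: "sigma_finite_measure M" and v [measurable]: "v \<in> borel_measurable M"
    and f [measurable]: "f \<in> borel_measurable borel" and E: "convex_body E"
  shows "weighted_perimeter (\<lambda>x. \<integral>\<^sup>+y. f (v y + x) \<partial>M) E = (\<integral>\<^sup>+y. weighted_perimeter f ((+) (v y) ` E) \<partial>M)"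
proof -
  interpret M: sigma_finite_measure M by (rule M)
  let ?H = "hausdorff_measure (CARD('n) - 1) :: (real ^ 'n) measure"
  let ?N = "density ?H (indicator (frontier E))"
  have meas [measurable]: "frontier E \<in> sets borel"
    by (simp add: borel_closed)
  have [measurable]: "(\<lambda>(x, y). f (v y + x)) \<in> borel_measurable (borel \<Otimes>\<^sub>M M)"
    by measurable
  have [measurable]: "(\<lambda>(y, x). f (v y + x)) \<in> borel_measurable (M \<Otimes>\<^sub>M borel)"
    by measurable
  have "emeasure ?N (space ?N) = hausdorff_outer_measure (DIM(real ^ 'n) - 1) (frontier E)"
    by (simp add: emeasure_density emeasure_hausdorff_measure)
  also have "\<dots> < \<infinity>"
    using E by (intro hausdorff_frontier_convex_finite) (auto simp: convex_body_def)
  finally interpret N: finite_measure ?N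
    by (intro finite_measureI) simp
  interpret P: pair_sigma_finite M ?N ..
  have "weighted_perimeter (\<lambda>x. \<integral>\<^sup>+y. f (v y + x) \<partial>M) E = (\<integral>\<^sup>+x. \<integral>\<^sup>+y. f (v y + x) \<partial>M \<partial>?N)"
    by (simp add: weighted_perimeter_def nn_integral_density mult.commute)
  also have "\<dots> = (\<integral>\<^sup>+y. \<integral>\<^sup>+x. f (v y + x) \<partial>?N \<partial>M)"
    by (rule P.Fubini') simp
  also have "\<dots> = (\<integral>\<^sup>+y. weighted_perimeter (\<lambda>x. f (v y + x)) E \<partial>M)"
    by (simp add: weighted_perimeter_def nn_integral_density mult.commute)
  finally show ?thesis
    by (simp add: weighted_perimeter_translation)
qed

lemma perimeter_monotone_average:
  fixes f :: "real ^ 'n \<Rightarrow> ennreal"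
  assumes "perimeter_monotone f" "sigma_finite_measure M" and v [measurable]: "v \<in> borel_measurable M"
  shows "perimeter_monotone (\<lambda>x. \<integral>\<^sup>+y. f (v y + x) \<partial>M)"
  unfolding perimeter_monotone_def
proof (intro conjI allI impI)
  interpret sigma_finite_measure M by fact
  have f [measurable]: "f \<in> borel_measurable borel"
    using assms(1) by (simp add: perimeter_monotone_def)
  show "(\<lambda>x. \<integral>\<^sup>+y. f (v y + x) \<partial>M) \<in> borel_measurable borel"
    by measurable
  fix A B :: "(real ^ 'n) set" assume AB: "convex_body A" "convex_body B" "A \<subseteq> B"
  have "weighted_perimeter f ((+) (v y) ` A) \<le> weighted_perimeter f ((+) (v y) ` B)" for y
    using AB assms(1) by (intro perimeter_monotoneD convex_body_translation image_mono)
  then show "weighted_perimeter (\<lambda>x. \<integral>\<^sup>+y. f (v y + x) \<partial>M) A \<le> weighted_perimeter (\<lambda>x. \<integral>\<^sup>+y. f (v y + x) \<partial>M) B"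
    unfolding weighted_perimeter_average[OF assms(2) v f AB(1)] weighted_perimeter_average[OF assms(2) v f AB(2)]
    by (rule nn_integral_mono)
qed

section \<open>Raising a conical roof\<close>

text \<open>
  The body \<open>A\<close> is the cylinder of radius \<open>r\<close> and height \<open>r\<close> below the disc \<open>D\<close>, and \<open>B\<close> is \<open>A\<close> with a cone of
  height \<open>t * r\<close> on top. The function \<open>q\<close> is the distance from the axis; it is a seminorm, which makes both bodies
  convex. Since the cone has height \<open>0\<close> above the rim of \<open>D\<close>, the lateral face does not change. The bound on \<open>F\<close>
  makes the integral over the common part of the boundaries finite, so that it cancels.
\<close>

lemma roof_inequality:
  fixes F :: "real ^ 'n \<Rightarrow> ennreal" and u :: "real ^ 'n"
  assumes F: "perimeter_monotone F" and bound: "\<And>x. norm x \<le> 2 * r \<Longrightarrow> F x \<le> ennreal K"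
    and u: "norm u = 1" and r: "0 < r" and t: "0 < t"
  defines "D \<equiv> {x. x \<bullet> u = 0 \<and> norm x < r}"
  shows "(\<integral>\<^sup>+x\<in>D. F x \<partial>hausdorff_measure (CARD('n) - 1))
    \<le> ennreal ((1 + t\<^sup>2) ^ (CARD('n) - 1)) *
       (\<integral>\<^sup>+x\<in>D. F (x + (t * (r - norm x)) *\<^sub>R u) \<partial>hausdorff_measure (CARD('n) - 1))"
proof -
  let ?m = "CARD('n) - 1"
  let ?H = "hausdorff_measure ?m :: (real ^ 'n) measure"
  define q where "q x = norm (x - (x \<bullet> u) *\<^sub>R u)" for x
  define h where "h x = x + (t * (r - norm x)) *\<^sub>R u" for x
  define A where "A = {x. - r \<le> x \<bullet> u \<and> x \<bullet> u \<le> 0 \<and> q x \<le> r}"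
  define B where "B = {x. - r \<le> x \<bullet> u \<and> q x \<le> r \<and> x \<bullet> u + t * q x \<le> t * r}"
  define O1 where "O1 = {x. - r < x \<bullet> u \<and> x \<bullet> u < 0 \<and> q x < r}"
  define O2 where "O2 = {x. - r < x \<bullet> u \<and> q x < r \<and> x \<bullet> u + t * q x < t * r}"
  have uu: "u \<bullet> u = 1"
    using u by (simp add: dot_square_norm)
  have Fm [measurable]: "F \<in> borel_measurable borel"
    using F by (simp add: perimeter_monotone_def)
  have q_cont: "continuous_on UNIV q"
    unfolding q_def by (intro continuous_intros)
  have q_nonneg: "0 \<le> q x" for x by (simp add: q_def)
  have q_convex: "q (a *\<^sub>R x + b *\<^sub>R y) \<le> a * q x + b * q y" if "0 \<le> a" "0 \<le> b" for a b x y
  proof -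
    have "(a *\<^sub>R x + b *\<^sub>R y) - ((a *\<^sub>R x + b *\<^sub>R y) \<bullet> u) *\<^sub>R u
        = a *\<^sub>R (x - (x \<bullet> u) *\<^sub>R u) + b *\<^sub>R (y - (y \<bullet> u) *\<^sub>R u)"
      by (simp add: inner_add_left algebra_simps)
    then show ?thesis
      using norm_triangle_ineq[of "a *\<^sub>R (x - (x \<bullet> u) *\<^sub>R u)" "b *\<^sub>R (y - (y \<bullet> u) *\<^sub>R u)"] that
      by (simp add: q_def)
  qed
  have norm_le: "norm x \<le> \<bar>x \<bullet> u\<bar> + q x" for x
    using norm_triangle_ineq[of "(x \<bullet> u) *\<^sub>R u" "x - (x \<bullet> u) *\<^sub>R u"] u by (simp add: q_def)
  have "A \<subseteq> B"
  proof
    fix x assume "x \<in> A"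
    moreover from this have "t * q x \<le> t * r"
      using t by (simp add: A_def)
    ultimately show "x \<in> B"
      by (simp add: A_def B_def)
  qed
  have clA: "closed A" and clB: "closed B"
    unfolding A_def B_def
    by (intro closed_Collect_conj closed_Collect_le continuous_intros q_cont)+
  have op: "open O1" "open O2"
    unfolding O1_def O2_def
    by (intro open_Collect_conj open_Collect_less continuous_intros q_cont)+
  have "O1 \<subseteq> A" "O2 \<subseteq> B"
    unfolding O1_def O2_def A_def B_def by auto
  moreover have "- (r / 2) *\<^sub>R u \<in> O1"
    using r by (simp add: O1_def q_def uu)
  ultimately have intA: "interior A \<noteq> {}" and O2: "O2 \<subseteq> interior B"
    using op interior_maximal by blast+
  have "norm x \<le> 2 * r + t * r" if "x \<in> B" for x
  proof -
    have "0 \<le> t * q x" "0 \<le> t * r"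
      using t r q_nonneg[of x] by simp_all
    moreover have "- r \<le> x \<bullet> u" "x \<bullet> u + t * q x \<le> t * r"
      using that by (simp_all add: B_def)
    ultimately have "\<bar>x \<bullet> u\<bar> \<le> r + t * r"
      using r unfolding abs_le_iff by linarith
    then show ?thesis
      using norm_le[of x] that by (simp add: B_def)
  qed
  then have bB: "bounded B"
    by (auto simp: bounded_iff)
  have "convex A"
    unfolding convex_def
  proof (intro ballI allI impI)
    fix x y :: "real ^ 'n" and a b :: real
    assume *: "x \<in> A" "y \<in> A" "0 \<le> a" "0 \<le> b" "a + b = 1"
    have "a * (x \<bullet> u) + b * (y \<bullet> u) \<le> 0"
      using * by (intro convex_bound_le) (auto simp: A_def)
    moreover have "a * (- (x \<bullet> u)) + b * (- (y \<bullet> u)) \<le> r"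
      using * by (intro convex_bound_le) (auto simp: A_def)
    moreover have "a * q x + b * q y \<le> r"
      using * by (intro convex_bound_le) (auto simp: A_def)
    ultimately show "a *\<^sub>R x + b *\<^sub>R y \<in> A"
      using q_convex[OF *(3,4), of x y] by (simp add: A_def inner_add_left)
  qed
  have "convex B"
    unfolding convex_def
  proof (intro ballI allI impI)
    fix x y :: "real ^ 'n" and a b :: real
    assume *: "x \<in> B" "y \<in> B" "0 \<le> a" "0 \<le> b" "a + b = 1"
    have "a * (x \<bullet> u + t * q x) + b * (y \<bullet> u + t * q y) \<le> t * r"
      using * by (intro convex_bound_le) (auto simp: B_def)
    moreover have "a * (- (x \<bullet> u)) + b * (- (y \<bullet> u)) \<le> r"
      using * by (intro convex_bound_le) (auto simp: B_def)
    moreover have "a * q x + b * q y \<le> r"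
      using * by (intro convex_bound_le) (auto simp: B_def)
    moreover have "t * q (a *\<^sub>R x + b *\<^sub>R y) \<le> t * (a * q x + b * q y)"
      using q_convex[OF *(3,4), of x y] t by (intro mult_left_mono) auto
    ultimately show "a *\<^sub>R x + b *\<^sub>R y \<in> B"
      using q_convex[OF *(3,4), of x y] by (simp add: B_def inner_add_left algebra_simps)
  qed
  have body: "convex_body A" "convex_body B"
    using \<open>convex A\<close> \<open>convex B\<close> clA clB bB bounded_subset[OF bB \<open>A \<subseteq> B\<close>] intA interior_mono[OF \<open>A \<subseteq> B\<close>]
    by (auto simp: convex_body_def compact_eq_bounded_closed)
  have D_A: "D \<subseteq> frontier A"
  proof
    fix x assume x: "x \<in> D"
    then have "x \<in> A" using r by (simp add: D_def A_def q_def)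
    moreover have "x \<notin> interior A"
    proof
      assume "x \<in> interior A"
      then obtain e where e: "0 < e" "cball x e \<subseteq> A"
        by (auto simp: mem_interior_cball)
      have "x + e *\<^sub>R u \<in> cball x e"
        using e(1) u by (simp add: dist_norm)
      then have "(x + e *\<^sub>R u) \<bullet> u \<le> 0"
        using e(2) by (auto simp: A_def)
      then show False
        using e(1) x by (simp add: D_def inner_add_left uu)
    qed
    ultimately show "x \<in> frontier A"
      using clA by (simp add: frontier_def)
  qed
  define T where "T = frontier B - (frontier A - D)"
  have T: "T \<subseteq> h ` D"
  proof
    fix x assume x: "x \<in> T"
    then have xB: "x \<in> B" "x \<notin> O2"
      using clB O2 by (auto simp: T_def frontier_def)
    define y where "y = x - (x \<bullet> u) *\<^sub>R u"
    have ny: "norm y = q x" "y \<bullet> u = 0"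
      by (simp_all add: y_def q_def inner_diff_left uu)
    \<comment> \<open>A boundary point of \<open>B\<close> at or below the level of \<open>D\<close> is a boundary point of \<open>A\<close>, and it is not in \<open>D\<close>
      because \<open>D\<close> lies in the interior of \<open>B\<close>.\<close>
    have pos: "0 < x \<bullet> u"
    proof (rule ccontr)
      assume neg: "\<not> 0 < x \<bullet> u"
      then have "x \<in> A" using xB(1) by (simp add: A_def B_def)
      moreover have "x \<notin> interior A"
        using x interior_mono[OF \<open>A \<subseteq> B\<close>] by (auto simp: T_def frontier_def)
      ultimately have "x \<in> D"
        using x clA by (auto simp: T_def frontier_def)
      then have "x \<in> O2"
        using r t by (simp add: O2_def D_def q_def)
      with xB(2) show False by simp
    qed
    have "x \<bullet> u + t * q x \<le> t * r"
      using xB(1) by (simp add: B_def)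
    with pos have "t * q x < t * r" by linarith
    then have "q x < r" using t by simp
    then have "x \<bullet> u = t * (r - norm y)"
      using xB pos r unfolding ny(1) by (auto simp: O2_def B_def right_diff_distrib)
    then have "h y = x"
      by (simp add: h_def) (simp add: y_def)
    moreover have "y \<in> D"
      using \<open>q x < r\<close> ny by (simp add: D_def)
    ultimately show "x \<in> h ` D" by blast
  qed
  have D_meas [measurable]: "D \<in> sets borel"
    unfolding D_def by measurable
  have [measurable]: "frontier A \<in> sets borel" "frontier B \<in> sets borel"
    by (simp_all add: borel_closed)
  then have T_meas [measurable]: "T \<in> sets borel"
    unfolding T_def by measurable
  have "h \<in> borel_measurable borel"
    unfolding h_def by measurable
  let ?I = "\<lambda>S. \<integral>\<^sup>+x\<in>S. F x \<partial>?H"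
  have add: "?I (S \<union> S') = ?I S + ?I S'" if "S \<inter> S' = {}" and [measurable]: "S \<in> sets borel" "S' \<in> sets borel" for S S'
  proof -
    have "?I (S \<union> S') = (\<integral>\<^sup>+x. F x * indicator S x + F x * indicator S' x \<partial>?H)"
      using that(1) by (intro nn_integral_cong) (auto split: split_indicator)
    also have "\<dots> = ?I S + ?I S'"
      by (rule nn_integral_add) auto
    finally show ?thesis .
  qed
  have lip: "dist (h x) (h y) \<le> (1 + t\<^sup>2) * dist x y" if "x \<in> D" "y \<in> D" for x y
  proof -
    \<comment> \<open>The vertical displacement is orthogonal to \<open>x - y\<close>, hence the stretch is quadratic in \<open>t\<close>.\<close>
    have "h x - h y = (x - y) + (t * (norm y - norm x)) *\<^sub>R u"
      by (simp add: h_def algebra_simps)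
    moreover have "orthogonal (x - y) ((t * (norm y - norm x)) *\<^sub>R u)"
      using that by (simp add: orthogonal_def D_def inner_diff_left)
    ultimately have "(norm (h x - h y))\<^sup>2 = (norm (x - y))\<^sup>2 + t\<^sup>2 * (norm y - norm x)\<^sup>2"
      using u by (simp add: norm_add_Pythagorean power_mult_distrib)
    also have "(norm y - norm x)\<^sup>2 \<le> (norm (x - y))\<^sup>2"
      using norm_triangle_ineq3[of y x] by (metis abs_le_square_iff abs_norm_cancel norm_minus_commute)
    then have "(norm (x - y))\<^sup>2 + t\<^sup>2 * (norm y - norm x)\<^sup>2 \<le> (1 + t\<^sup>2) * (norm (x - y))\<^sup>2"
      by (simp add: distrib_right mult_left_mono)
    also have "\<dots> \<le> (1 + t\<^sup>2)\<^sup>2 * (norm (x - y))\<^sup>2"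
      by (intro mult_right_mono self_le_power) auto
    finally have "(norm (h x - h y))\<^sup>2 \<le> ((1 + t\<^sup>2) * norm (x - y))\<^sup>2"
      by (simp only: power_mult_distrib)
    then show ?thesis
      unfolding dist_norm by (rule power2_le_imp_le) simp
  qed
  have "?I (frontier A) \<le> (\<integral>\<^sup>+x. ennreal K * indicator (frontier A) x \<partial>?H)"
  proof (intro nn_integral_mono)
    fix x
    show "F x * indicator (frontier A) x \<le> ennreal K * indicator (frontier A) x"
    proof (cases "x \<in> frontier A")
      case True
      then have "x \<in> A" using clA by (auto simp: frontier_def)
      then have "norm x \<le> 2 * r" using norm_le[of x] by (auto simp: A_def)
      then show ?thesis using bound by (simp add: mult_right_mono)
    qed simp
  qed
  also have "\<dots> = ennreal K * hausdorff_outer_measure (DIM(real ^ 'n) - 1) (frontier A)"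
    by (simp add: nn_integral_cmult emeasure_hausdorff_measure)
  also have "\<dots> < \<infinity>"
    using hausdorff_frontier_convex_finite[of A] body(1) by (simp add: convex_body_def ennreal_mult_less_top)
  finally have "?I (frontier A) < \<infinity>" .
  moreover have split: "?I (frontier A) = ?I (frontier A - D) + ?I D"
    using D_A by (subst add[symmetric]) (auto simp: Un_absorb2)
  ultimately have fin: "?I (frontier A - D) \<noteq> \<infinity>"
    by (auto simp: less_top)
  have "?I (frontier A - D) + ?I D \<le> ?I (frontier B)"
    using perimeter_monotoneD[OF F body \<open>A \<subseteq> B\<close>] by (simp only: weighted_perimeter_def split)
  also have "\<dots> \<le> ?I ((frontier A - D) \<union> T)"
    by (intro nn_integral_mono) (auto simp: T_def split: split_indicator)
  also have "\<dots> = ?I (frontier A - D) + ?I T"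
    by (rule add) (auto simp: T_def)
  finally have "?I D \<le> ?I T"
    using fin by (simp add: ennreal_add_left_cancel_le)
  also have "\<dots> \<le> ennreal ((1 + t\<^sup>2) ^ ?m) * (\<integral>\<^sup>+x\<in>D. F (h x) \<partial>?H)"
    by (rule nn_integral_hausdorff_lipschitz)
      (use lip T \<open>h \<in> borel_measurable borel\<close> in \<open>auto intro: add_pos_nonneg\<close>)
  finally show ?thesis
    by (simp only: h_def)
qed

section \<open>Integrals over translated boxes\<close>

text \<open>
  The integral of \<open>f\<close> over the box translated by \<open>x\<close>, in the form in which \<open>perimeter_monotone_average\<close>
  produces it.
\<close>

definition box_integral :: "(real ^ 'n \<Rightarrow> ennreal) \<Rightarrow> real ^ 'n \<Rightarrow> real ^ 'n \<Rightarrow> real ^ 'n \<Rightarrow> ennreal" where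
  "box_integral f l h x = (\<integral>\<^sup>+y. f (y + x) \<partial>density lborel (indicator (box l h)))"

lemma box_integral_translate:
  fixes f :: "real ^ 'n \<Rightarrow> ennreal"
  assumes [measurable]: "f \<in> borel_measurable borel"
  shows "box_integral f l h x = (\<integral>\<^sup>+z. f z * indicator (box l h) (z - x) \<partial>lborel)"
proof -
  have "(\<integral>\<^sup>+z. f z * indicator (box l h) (z - x) \<partial>lborel)
      = (\<integral>\<^sup>+z. f z * indicator (box l h) (z - x) \<partial>distr lborel borel ((+) x))"
    by (simp add: lborel_distr_plus)
  also have "\<dots> = (\<integral>\<^sup>+y. f (x + y) * indicator (box l h) y \<partial>lborel)"
    by (subst nn_integral_distr) auto
  finally show ?thesis
    by (simp add: box_integral_def nn_integral_density add.commute mult.commute)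
qed

lemma locally_integrable_lborel:
  fixes f :: "real ^ 'n \<Rightarrow> ennreal"
  assumes "locally_integrable f"
  shows "(\<integral>\<^sup>+x\<in>cball 0 R. f x \<partial>lborel) < \<infinity>"
  using assms unfolding locally_integrable_def nn_integral_completion by auto

lemma box_integral_bounded:
  fixes f :: "real ^ 'n \<Rightarrow> ennreal"
  assumes f: "f \<in> borel_measurable borel" "locally_integrable f"
  shows "\<exists>K::real. \<forall>x. norm x \<le> R \<longrightarrow> box_integral f l h x \<le> ennreal K"
proof -
  obtain S where S: "\<And>y. y \<in> box l h \<Longrightarrow> norm y \<le> S"
    using bounded_box[of l h] by (auto simp: bounded_iff)
  let ?K = "\<integral>\<^sup>+z\<in>cball 0 (R + S). f z \<partial>lborel"
  have "box_integral f l h x \<le> ?K" if "norm x \<le> R" for x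
    unfolding box_integral_translate[OF f(1)]
  proof (intro nn_integral_mono mult_left_mono)
    fix z
    show "(indicator (box l h) (z - x) :: ennreal) \<le> indicator (cball 0 (R + S)) z"
    proof (cases "z - x \<in> box l h")
      case True
      then have "norm z \<le> R + S"
        using S[OF True] that norm_triangle_ineq[of x "z - x"] by simp
      then show ?thesis by (simp add: indicator_def)
    qed simp
  qed simp
  moreover have "?K = ennreal (enn2real ?K)"
    using locally_integrable_lborel[OF f(2)] by (simp add: less_top)
  ultimately show ?thesis by (metis (no_types, lifting))
qed

lemma box_integral_finite:
  assumes "f \<in> borel_measurable borel" "locally_integrable f"
  shows "box_integral f l h x < \<infinity>"
  using box_integral_bounded[OF assms, of "norm x" l h]
  by (metis ennreal_less_top infinity_ennreal_def order.strict_trans1 order_refl)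

text \<open>
  Dominated convergence: the indicators of the translated boxes converge except on the boundary of
  the limit box, a null set.
\<close>

lemma isCont_box_integral:
  fixes f :: "real ^ 'n \<Rightarrow> ennreal"
  assumes f [measurable]: "f \<in> borel_measurable borel" and li: "locally_integrable f"
  shows "isCont (box_integral f l h) x"
  unfolding continuous_at_sequentially
proof (intro allI impI)
  fix X :: "nat \<Rightarrow> real ^ 'n" assume X: "X \<longlonglongrightarrow> x"
  obtain S where S: "\<And>y. y \<in> box l h \<Longrightarrow> norm y \<le> S"
    using bounded_box[of l h] by (auto simp: bounded_iff)
  obtain R where R: "\<And>n. norm (X n) \<le> R"
    using convergent_imp_bounded[OF X] by (auto simp: bounded_iff)
  let ?Z = "cbox (l + x) (h + x) - box (l + x) (h + x)"
  have "?Z \<in> null_sets lborel"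
    using negligible_frontier_interval[of "l + x" "h + x"]
    by (simp add: negligible_iff_null_sets null_sets_completion_iff)
  then have AE_Z: "AE z in lborel. z \<notin> ?Z"
    by (rule AE_not_in)
  have [measurable]: "cball (0 :: real ^ 'n) (R + S) \<in> sets borel"
    by simp
  have "(\<lambda>n. \<integral>\<^sup>+z. f z * indicator (box l h) (z - X n) \<partial>lborel)
      \<longlonglongrightarrow> (\<integral>\<^sup>+z. f z * indicator (box l h) (z - x) \<partial>lborel)"
  proof (rule nn_integral_dominated_convergence[where w = "\<lambda>z. f z * indicator (cball 0 (R + S)) z"])
    show "(\<integral>\<^sup>+z\<in>cball 0 (R + S). f z \<partial>lborel) < \<infinity>"
      by (rule locally_integrable_lborel[OF li])
    show "AE z in lborel. f z * indicator (box l h) (z - X n) \<le> f z * indicator (cball 0 (R + S)) z" for n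
    proof (intro AE_I2 mult_left_mono)
      fix z
      show "(indicator (box l h) (z - X n) :: ennreal) \<le> indicator (cball 0 (R + S)) z"
      proof (cases "z - X n \<in> box l h")
        case True
        then have "norm z \<le> R + S"
          using S[OF True] R[of n] norm_triangle_ineq[of "X n" "z - X n"] by simp
        then show ?thesis by (simp add: indicator_def)
      qed simp
    qed simp
    show "AE z in lborel. (\<lambda>n. f z * indicator (box l h) (z - X n)) \<longlonglongrightarrow> f z * indicator (box l h) (z - x)"
      using AE_Z
    proof eventually_elim
      fix z assume z: "z \<notin> ?Z"
      have lim: "(\<lambda>n. z - X n) \<longlonglongrightarrow> z - x"
        using X by (intro tendsto_intros)
      have "eventually (\<lambda>n. z - X n \<in> box l h \<longleftrightarrow> z - x \<in> box l h) sequentially"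
      proof (cases "z - x \<in> box l h")
        case True
        then show ?thesis
          using topological_tendstoD[OF lim open_box True] by simp
      next
        case False
        then have "z - x \<notin> cbox l h"
          using z by (auto simp: mem_box inner_diff_left inner_add_left algebra_simps)
        then have "eventually (\<lambda>n. z - X n \<in> - cbox l h) sequentially"
          using topological_tendstoD[OF lim, of "- cbox l h"] by auto
        then show ?thesis
          using False box_subset_cbox[of l h] by (auto elim!: eventually_mono)
      qed
      then show "(\<lambda>n. f z * indicator (box l h) (z - X n)) \<longlonglongrightarrow> f z * indicator (box l h) (z - x)"
        by (intro tendsto_eventually) (erule eventually_mono, simp add: indicator_def)
    qed
  qed measurable
  then show "(box_integral f l h \<circ> X) \<longlonglongrightarrow> box_integral f l h x"
    by (simp add: comp_def box_integral_translate)
qed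

text \<open>
  Shifting the window of integration \<open>{0..\<rho>}\<close> by \<open>\<tau>\<close> loses the values near \<open>0\<close>, which are at least \<open>b\<close>, and gains
  those near \<open>\<rho>\<close>, which are at most \<open>a\<close>. The terms with \<open>a\<close> and \<open>b\<close> stand on opposite sides, since
  the extended nonnegative reals have no proper subtraction.
\<close>

lemma nn_integral_shift_le:
  fixes G :: "real \<Rightarrow> ennreal"
  assumes [measurable]: "G \<in> borel_measurable borel" and "0 \<le> \<tau>" "0 \<le> \<rho>"
    and lower: "\<And>s. 0 \<le> s \<Longrightarrow> s \<le> \<tau> \<Longrightarrow> b \<le> G s"
    and upper: "\<And>s. \<rho> \<le> s \<Longrightarrow> s \<le> \<rho> + \<tau> \<Longrightarrow> G s \<le> a"
  shows "(\<integral>\<^sup>+s\<in>{0..\<rho>}. G (\<tau> + s) \<partial>lborel) + b * ennreal \<tau> \<le> (\<integral>\<^sup>+s\<in>{0..\<rho>}. G s \<partial>lborel) + a * ennreal \<tau>"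
proof -
  have "(\<integral>\<^sup>+s\<in>{0..\<rho>}. G (\<tau> + s) \<partial>lborel) = (\<integral>\<^sup>+s. G s * indicator {\<tau>..\<rho> + \<tau>} s \<partial>distr lborel borel ((+) \<tau>))"
    by (subst nn_integral_distr) (auto intro!: nn_integral_cong split: split_indicator)
  also have "\<dots> = (\<integral>\<^sup>+s\<in>{\<tau>..\<rho> + \<tau>}. G s \<partial>lborel)"
    by (simp add: lborel_distr_plus)
  finally have shift: "(\<integral>\<^sup>+s\<in>{0..\<rho>}. G (\<tau> + s) \<partial>lborel) = (\<integral>\<^sup>+s\<in>{\<tau>..\<rho> + \<tau>}. G s \<partial>lborel)" .
  have "b * ennreal \<tau> = (\<integral>\<^sup>+s. b * indicator {0..<\<tau>} s \<partial>lborel)"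
    using \<open>0 \<le> \<tau>\<close> by (simp add: nn_integral_cmult)
  also have "\<dots> \<le> (\<integral>\<^sup>+s\<in>{0..<\<tau>}. G s \<partial>lborel)"
    by (intro nn_integral_mono) (auto split: split_indicator intro: lower)
  finally have "(\<integral>\<^sup>+s\<in>{0..\<rho>}. G (\<tau> + s) \<partial>lborel) + b * ennreal \<tau>
      \<le> (\<integral>\<^sup>+s\<in>{\<tau>..\<rho> + \<tau>}. G s \<partial>lborel) + (\<integral>\<^sup>+s\<in>{0..<\<tau>}. G s \<partial>lborel)"
    unfolding shift by (rule add_left_mono)
  also have "\<dots> = (\<integral>\<^sup>+s. G s * indicator {\<tau>..\<rho> + \<tau>} s + G s * indicator {0..<\<tau>} s \<partial>lborel)"
    by (rule nn_integral_add[symmetric]) auto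
  also have "\<dots> = (\<integral>\<^sup>+s. G s * indicator {0..\<rho>} s + G s * indicator {\<rho><..\<rho> + \<tau>} s \<partial>lborel)"
    using \<open>0 \<le> \<tau>\<close> \<open>0 \<le> \<rho>\<close> by (intro nn_integral_cong) (auto split: split_indicator)
  also have "\<dots> = (\<integral>\<^sup>+s\<in>{0..\<rho>}. G s \<partial>lborel) + (\<integral>\<^sup>+s\<in>{\<rho><..\<rho> + \<tau>}. G s \<partial>lborel)"
    by (rule nn_integral_add) auto
  also have "(\<integral>\<^sup>+s\<in>{\<rho><..\<rho> + \<tau>}. G s \<partial>lborel) \<le> (\<integral>\<^sup>+s. a * indicator {\<rho><..\<rho> + \<tau>} s \<partial>lborel)"
    by (intro nn_integral_mono) (auto split: split_indicator intro: upper)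
  also have "\<dots> = a * ennreal \<tau>"
    using \<open>0 \<le> \<tau>\<close> by (simp add: nn_integral_cmult)
  finally show ?thesis by (simp add: add_left_mono)
qed

text \<open>
  With \<open>c\<close> the integral of \<open>f\<close> over the unit cube, a double integral over the unit cube and an
  arbitrary box, computed in both orders, shows that the integral of \<open>f\<close> over the box is \<open>c\<close> times its volume.
  A measure is determined by its finite values on boxes, and a density by its measure.
\<close>

lemma AE_constant_if_box_integrals_constant:
  fixes f :: "real ^ 'n \<Rightarrow> ennreal"
  assumes f [measurable]: "f \<in> borel_measurable borel" and li: "locally_integrable f"
    and const: "\<And>l h x. box_integral f l h x = box_integral f l h 0"
  shows "\<exists>c::real. c \<ge> 0 \<and> (AE x in lebesgue. f x = ennreal c)"
proof -
  let ?Q = "box 0 One :: (real ^ 'n) set"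
  define c where "c = box_integral f 0 One 0"
  have "c < \<infinity>"
    unfolding c_def by (rule box_integral_finite[OF f li])
  have boxes: "emeasure (density lborel f) (box l h) = emeasure (density lborel (\<lambda>_. c)) (box l h)" for l h :: "real ^ 'n"
  proof -
    have "emeasure (density lborel f) (box l h) = box_integral f l h 0"
      by (simp add: emeasure_density box_integral_def nn_integral_density mult.commute)
    also have "\<dots> = (\<integral>\<^sup>+x\<in>?Q. box_integral f l h x \<partial>lborel)"
      by (subst const) (simp add: nn_integral_cmult)
    also have "\<dots> = (\<integral>\<^sup>+x. (\<integral>\<^sup>+y. f (y + x) * indicator (box l h) y * indicator ?Q x \<partial>lborel) \<partial>lborel)"
      by (intro nn_integral_cong, subst nn_integral_multc) (auto simp: box_integral_def nn_integral_density mult.commute)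
    also have "\<dots> = (\<integral>\<^sup>+y. (\<integral>\<^sup>+x. f (y + x) * indicator (box l h) y * indicator ?Q x \<partial>lborel) \<partial>lborel)"
      by (rule lborel_pair.Fubini') measurable
    also have "\<dots> = (\<integral>\<^sup>+y\<in>box l h. box_integral f 0 One y \<partial>lborel)"
    proof (intro nn_integral_cong)
      fix y
      have "(\<integral>\<^sup>+x. f (y + x) * indicator (box l h) y * indicator ?Q x \<partial>lborel)
          = (\<integral>\<^sup>+x. (f (x + y) * indicator ?Q x) * indicator (box l h) y \<partial>lborel)"
        by (simp add: mult_ac add.commute)
      also have "\<dots> = (\<integral>\<^sup>+x. f (x + y) * indicator ?Q x \<partial>lborel) * indicator (box l h) y"
        by (rule nn_integral_multc) measurable
      also have "(\<integral>\<^sup>+x. f (x + y) * indicator ?Q x \<partial>lborel) = box_integral f 0 One y"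
        by (simp add: box_integral_def nn_integral_density mult.commute)
      finally show "(\<integral>\<^sup>+x. f (y + x) * indicator (box l h) y * indicator ?Q x \<partial>lborel)
          = box_integral f 0 One y * indicator (box l h) y" .
    qed
    also have "\<dots> = (\<integral>\<^sup>+y. c * indicator (box l h) y \<partial>lborel)"
      by (subst const) (simp add: c_def)
    also have "\<dots> = emeasure (density lborel (\<lambda>_. c)) (box l h)"
      by (simp add: emeasure_density)
    finally show ?thesis .
  qed
  have eq: "density lborel (\<lambda>_. c) = density lborel f"
  proof (rule measure_eqI_generator_eq)
    let ?E = "range (\<lambda>(a, b). box a b :: (real ^ 'n) set)"
    show "Int_stable ?E"
      by (auto simp: Int_stable_def box_Int_box)
    show "?E \<subseteq> Pow UNIV" "sets (density lborel (\<lambda>_. c)) = sigma_sets UNIV ?E" "sets (density lborel f) = sigma_sets UNIV ?E"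
      by (simp_all add: borel_eq_box sets_borel)
    let ?A = "\<lambda>n::nat. box (- (real n *\<^sub>R One)) (real n *\<^sub>R One) :: (real ^ 'n) set"
    show "range ?A \<subseteq> ?E" "(\<Union>i. ?A i) = UNIV"
      unfolding UN_box_eq_UNIV by auto
    show "emeasure (density lborel (\<lambda>_. c)) (?A i) \<noteq> \<infinity>" for i
      using \<open>c < \<infinity>\<close> emeasure_lborel_box_finite[of "- (real i *\<^sub>R One) :: real ^ 'n" "real i *\<^sub>R One"]
      by (simp add: emeasure_density nn_integral_cmult ennreal_mult_eq_top_iff less_top[symmetric])
    show "emeasure (density lborel (\<lambda>_. c)) X = emeasure (density lborel f) X" if "X \<in> ?E" for X
      using that boxes by auto
  qed
  have "sigma_finite_measure (density lborel (\<lambda>_::real ^ 'n. c))"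
    using \<open>c < \<infinity>\<close> by (subst sigma_finite_measure.sigma_finite_iff_density_finite[OF sigma_finite_lborel]) auto
  then have "AE x in lborel. c = f x"
    using sigma_finite_density_unique[of "\<lambda>_. c" lborel f] eq by simp
  then have "AE x in lebesgue. f x = ennreal (enn2real c)"
    using \<open>c < \<infinity>\<close> by (intro AE_completion) (auto simp: less_top)
  then show ?thesis
    by (intro exI[of _ "enn2real c"]) simp
qed

section \<open>First variation of the roof\<close>

lemma one_plus_power_le:
  fixes s :: real
  assumes "0 \<le> s" "s \<le> 1"
  shows "(1 + s) ^ m \<le> 1 + 3 ^ m * s"
proof (induction m)
  case (Suc m)
  have "(1 + s) ^ Suc m \<le> (1 + 3 ^ m * s) * (1 + s)"
    using Suc assms by (simp add: mult.commute mult_right_mono)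
  also have "\<dots> = 1 + s + 3 ^ m * s + 3 ^ m * (s * s)"
    by (simp add: algebra_simps)
  also have "\<dots> \<le> 1 + 3 ^ m * s + 3 ^ m * s + 3 ^ m * s"
  proof -
    have "s \<le> 3 ^ m * s"
      using assms mult_right_mono[of 1 "3 ^ m" s] by simp
    moreover have "3 ^ m * (s * s) \<le> 3 ^ m * s"
      using assms by (intro mult_left_mono) (auto simp: mult_left_le)
    ultimately show ?thesis by linarith
  qed
  finally show ?case by (simp add: mult_ac add.commute)
qed (use assms in simp)

text \<open>
  The first-order gain \<open>c * t * j\<close> beats the second-order loss \<open>3 ^ m * t\<^sup>2 * i\<close> for small \<open>t\<close>.
\<close>

lemma no_first_order_gain:
  fixes i j c :: real
  assumes "0 < j" "0 < c" "0 \<le> i"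
    and step: "\<And>t. 0 < t \<Longrightarrow> t \<le> 1 \<Longrightarrow> i \<le> (1 + t\<^sup>2) ^ m * (i - c * t * j)"
  shows False
proof -
  define C where "C = (3 ^ m :: real)"
  have "0 < C" by (simp add: C_def)
  have key: "c * j \<le> C * t * i" if t: "0 < t" "t \<le> 1" for t
  proof -
    have "t\<^sup>2 \<le> 1" using t by (simp add: power_le_one)
    have pos: "0 \<le> i - c * t * j"
    proof -
      have "0 \<le> (1 + t\<^sup>2) ^ m * (i - c * t * j)"
        using step[OF t] \<open>0 \<le> i\<close> by linarith
      moreover have "0 < (1 + t\<^sup>2) ^ m"
        by (intro zero_less_power) (simp add: add_pos_nonneg)
      ultimately show ?thesis
        by (simp add: zero_le_mult_iff)
    qed
    have "i \<le> (1 + C * t\<^sup>2) * (i - c * t * j)"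
      using step[OF t] mult_right_mono[OF one_plus_power_le[of "t\<^sup>2" m] pos] \<open>t\<^sup>2 \<le> 1\<close>
      by (simp add: C_def)
    also have "\<dots> = (i - c * t * j) + C * t\<^sup>2 * (i - c * t * j)"
      by (simp add: distrib_right)
    also have "\<dots> \<le> (i - c * t * j) + C * t\<^sup>2 * i"
      using assms(1,2) t \<open>0 < C\<close> by (intro add_left_mono mult_left_mono) auto
    finally have "t * (c * j) \<le> t * (C * t * i)"
      by (simp add: power2_eq_square mult_ac)
    then show ?thesis using t by simp
  qed
  \<comment> \<open>This makes \<open>C * t * i\<close> at most half of \<open>c * j\<close>; the summand 1 avoids division by zero.\<close>
  define t where "t = min 1 (c * j / (2 * (C * i + 1)))"
  have p: "0 < C * i + 1" "0 < c * j"
    using assms \<open>0 < C\<close> by (auto intro: add_nonneg_pos)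
  have t: "0 < t" "t \<le> 1"
    using p by (auto simp: t_def)
  have "C * t * i \<le> t * (C * i + 1)"
    using t by (simp add: algebra_simps)
  also have "\<dots> \<le> (c * j / (2 * (C * i + 1))) * (C * i + 1)"
    using p by (intro mult_right_mono) (auto simp: t_def)
  also have "\<dots> = c * j / 2"
  proof -
    have "y / (2 * k) * k = y / 2" if "0 < k" for y k :: real
      using that by simp
    then show ?thesis using p(1) .
  qed
  finally show False
    using key[OF t] p by simp
qed

text \<open>
  Here \<open>I\<close> is the integral of \<open>F\<close> over the disc and \<open>R t\<close> that of \<open>F\<close> moved up to the roof of slope \<open>t\<close>. The
  decrease of \<open>F\<close> gives \<open>R t + c * t * J \<le> I\<close>, where \<open>J\<close> is the volume under the roof of slope 1, while the roof
  inequality bounds \<open>I\<close> by \<open>R t\<close> up to a factor \<open>1 + O(t\<^sup>2)\<close>.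
\<close>

lemma perimeter_monotone_no_decrease:
  fixes F :: "real ^ 'n \<Rightarrow> ennreal"
  assumes F: "perimeter_monotone F" and bound: "\<And>x. norm x \<le> 2 * r \<Longrightarrow> F x \<le> ennreal K"
    and u: "u \<in> Basis \<or> - u \<in> Basis" and "0 < r" "0 < c"
    and decrease: "\<And>x \<tau>. norm x < r \<Longrightarrow> 0 \<le> \<tau> \<Longrightarrow> \<tau> \<le> r \<Longrightarrow> F (x + \<tau> *\<^sub>R u) + ennreal (c * \<tau>) \<le> F x"
  shows False
proof -
  let ?m = "CARD('n) - 1"
  let ?H = "hausdorff_measure ?m :: (real ^ 'n) measure"
  define D where "D s = {x. x \<bullet> u = 0 \<and> norm x < s}" for s
  have Fm [measurable]: "F \<in> borel_measurable borel"
    using F by (simp add: perimeter_monotone_def)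
  have [measurable]: "D s \<in> sets borel" for s
    unfolding D_def by measurable
  have "norm u = 1"
    using u norm_Basis[of u] norm_Basis[of "- u"] by auto
  obtain v where v: "v \<in> Basis" "D = (\<lambda>s. {x. x \<bullet> v = 0 \<and> norm x < s})"
    using u by (auto simp: D_def fun_eq_iff)
  have D_pos: "0 < emeasure ?H (D s)" if "0 < s" for s
    using hausdorff_flat_disc_pos[OF v(1) that] by (simp add: emeasure_hausdorff_measure) (simp add: v(2))
  have "emeasure ?H (D r) \<le> hausdorff_outer_measure (DIM(real ^ 'n) - 1) {x. x \<bullet> v = 0 \<and> (\<forall>b\<in>Basis. \<bar>x \<bullet> b\<bar> \<le> r)}"
  proof (simp add: emeasure_hausdorff_measure, rule hausdorff_outer_measure_mono, safe)
    fix x assume x: "x \<in> D r"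
    show "x \<bullet> v = 0" using x by (simp add: v(2))
    fix b :: "real ^ 'n" assume "b \<in> Basis"
    then show "\<bar>x \<bullet> b\<bar> \<le> r"
      using Basis_le_norm[of b x] x by (simp add: D_def)
  qed
  also have "\<dots> < \<infinity>"
    by (rule hausdorff_flat_finite[OF v(1)])
  finally have D_fin: "emeasure ?H (D r) < \<infinity>" .
  define I where "I = (\<integral>\<^sup>+x\<in>D r. F x \<partial>?H)"
  define J where "J = (\<integral>\<^sup>+x\<in>D r. ennreal (r - norm x) \<partial>?H)"
  define R where "R t = (\<integral>\<^sup>+x\<in>D r. F (x + (t * (r - norm x)) *\<^sub>R u) \<partial>?H)" for t
  have "I \<le> (\<integral>\<^sup>+x. ennreal K * indicator (D r) x \<partial>?H)"
    unfolding I_def by (intro nn_integral_mono) (use \<open>0 < r\<close> in \<open>auto simp: D_def split: split_indicator intro!: bound\<close>)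
  also have "\<dots> < \<infinity>"
    using D_fin by (simp add: nn_integral_cmult ennreal_mult_less_top)
  finally have I_fin: "I < \<infinity>" .
  have "J \<le> (\<integral>\<^sup>+x. ennreal r * indicator (D r) x \<partial>?H)"
    unfolding J_def by (intro nn_integral_mono) (auto split: split_indicator intro!: ennreal_leI)
  also have "\<dots> < \<infinity>"
    using D_fin by (simp add: nn_integral_cmult ennreal_mult_less_top)
  finally have J_fin: "J < \<infinity>" .
  have "0 < ennreal (r / 2) * emeasure ?H (D (r / 2))"
    using D_pos[of "r / 2"] \<open>0 < r\<close> by (simp add: ennreal_zero_less_mult_iff)
  also have "\<dots> = (\<integral>\<^sup>+x. ennreal (r / 2) * indicator (D (r / 2)) x \<partial>?H)"
    by (simp add: nn_integral_cmult)
  also have "\<dots> \<le> J"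
    unfolding J_def by (intro nn_integral_mono)
      (use \<open>0 < r\<close> in \<open>auto simp: D_def split: split_indicator intro!: ennreal_leI\<close>)
  finally have J_pos: "0 < J" .
  have roof: "I \<le> ennreal ((1 + t\<^sup>2) ^ ?m) * R t" if "0 < t" for t
    unfolding I_def R_def D_def
    by (rule roof_inequality[OF F bound \<open>norm u = 1\<close> \<open>0 < r\<close> that])
  have drop: "R t + ennreal (c * t) * J \<le> I" if t: "0 < t" "t \<le> 1" for t
  proof -
    have "R t + ennreal (c * t) * J = (\<integral>\<^sup>+x. F (x + (t * (r - norm x)) *\<^sub>R u) * indicator (D r) x
        + ennreal (c * t) * (ennreal (r - norm x) * indicator (D r) x) \<partial>?H)"
      unfolding R_def J_def by (subst nn_integral_add) (auto simp: nn_integral_cmult)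
    also have "\<dots> \<le> I"
      unfolding I_def
    proof (intro nn_integral_mono)
      fix x
      show "F (x + (t * (r - norm x)) *\<^sub>R u) * indicator (D r) x
          + ennreal (c * t) * (ennreal (r - norm x) * indicator (D r) x) \<le> F x * indicator (D r) x"
      proof (cases "x \<in> D r")
        case True
        then have x: "norm x < r" by (simp add: D_def)
        have "t * (r - norm x) \<le> 1 * r"
          using t x \<open>0 < r\<close> by (intro mult_mono) auto
        then have "F (x + (t * (r - norm x)) *\<^sub>R u) + ennreal (c * (t * (r - norm x))) \<le> F x"
          using t x by (intro decrease) auto
        moreover have "ennreal (c * (t * (r - norm x))) = ennreal (c * t) * ennreal (r - norm x)"
          using t x \<open>0 < c\<close> by (simp add: ennreal_mult[symmetric] mult.assoc)
        ultimately show ?thesis using True by simp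
      qed simp
    qed
    finally show ?thesis .
  qed
  define i where "i = enn2real I"
  define j where "j = enn2real J"
  have i: "I = ennreal i" "0 \<le> i" and j: "J = ennreal j" "0 < j"
    using I_fin J_fin J_pos by (auto simp: i_def j_def less_top enn2real_positive_iff)
  show False
  proof (rule no_first_order_gain[OF j(2) \<open>0 < c\<close> i(2)])
    fix t :: real assume t: "0 < t" "t \<le> 1"
    have "R t \<le> I"
      using drop[OF t] by (meson le_iff_add order_trans)
    then have "R t < \<infinity>"
      using I_fin by (rule order.strict_trans1)
    then obtain p where p: "R t = ennreal p" "0 \<le> p"
      by (cases "R t") auto
    have "ennreal (p + c * t * j) \<le> ennreal i"
      using drop[OF t] p t \<open>0 < c\<close> j i by (simp add: ennreal_mult[symmetric])
    then have "p + c * t * j \<le> i"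
      using i(2) by simp
    have "ennreal i \<le> ennreal ((1 + t\<^sup>2) ^ ?m * p)"
      using roof[OF t(1)] p i by (simp add: ennreal_mult)
    then have "i \<le> (1 + t\<^sup>2) ^ ?m * p"
      using p(2) by simp
    also have "\<dots> \<le> (1 + t\<^sup>2) ^ ?m * (i - c * t * j)"
      using \<open>p + c * t * j \<le> i\<close> by (intro mult_left_mono) auto
    finally show "i \<le> (1 + t\<^sup>2) ^ ?m * (i - c * t * j)" .
  qed
qed

text \<open>
  If \<open>g = box_integral f l h\<close> were smaller at \<open>x\<^sub>0 + \<rho> *\<^sub>R u\<close> than at \<open>x\<^sub>0\<close>, it would, by continuity, be
  smaller by a fixed amount \<open>c\<close> at \<open>x + \<rho> *\<^sub>R u\<close> than at \<open>x\<close>, for all \<open>x\<close> near \<open>x\<^sub>0\<close>. Then the integral \<open>F\<close> of \<open>g\<close> along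
  segments of length \<open>\<rho>\<close> parallel to \<open>u\<close> decreases at rate \<open>c\<close> in the direction \<open>u\<close>, which is impossible.
\<close>

lemma box_integral_directional_mono:
  fixes f :: "real ^ 'n \<Rightarrow> ennreal"
  assumes mono: "perimeter_monotone f" and li: "locally_integrable f"
    and u: "u \<in> Basis \<or> - u \<in> Basis" and "0 \<le> \<rho>"
  shows "box_integral f l h x\<^sub>0 \<le> box_integral f l h (x\<^sub>0 + \<rho> *\<^sub>R u)"
proof (rule ccontr)
  define g where "g = box_integral f l h"
  assume "\<not> ?thesis"
  then have less: "g (x\<^sub>0 + \<rho> *\<^sub>R u) < g x\<^sub>0" by (simp add: g_def)
  have f: "f \<in> borel_measurable borel"
    using mono by (simp add: perimeter_monotone_def)
  have "norm u = 1"
    using u norm_Basis[of u] norm_Basis[of "- u"] by auto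
  have g_mono: "perimeter_monotone g"
  proof -
    have "finite_measure (density lborel (indicator (box l h)))"
      using emeasure_lborel_box_finite[of l h] by (intro finite_measureI) (simp add: emeasure_density less_top)
    then have "perimeter_monotone (\<lambda>x. \<integral>\<^sup>+y. f (y + x) \<partial>density lborel (indicator (box l h)))"
      by (intro perimeter_monotone_average[OF mono]) (auto intro: finite_measure.axioms(1))
    then show ?thesis
      by (simp add: g_def box_integral_def[abs_def])
  qed
  have [measurable]: "g \<in> borel_measurable borel"
    using g_mono by (simp add: perimeter_monotone_def)
  have cont: "isCont g x" for x
    unfolding g_def by (rule isCont_box_integral[OF f li])
  obtain a b where ab: "g (x\<^sub>0 + \<rho> *\<^sub>R u) < a" "a < b" "b < g x\<^sub>0"
    using less dense by meson
  have "eventually (\<lambda>x. b < g x) (nhds x\<^sub>0)"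
    using cont[of x\<^sub>0] ab(3) by (auto simp: isCont_def tendsto_at_iff_tendsto_nhds intro: order_tendstoD)
  moreover have "eventually (\<lambda>x. g x < a) (nhds (x\<^sub>0 + \<rho> *\<^sub>R u))"
    using cont[of "x\<^sub>0 + \<rho> *\<^sub>R u"] ab(1) by (auto simp: isCont_def tendsto_at_iff_tendsto_nhds intro: order_tendstoD)
  ultimately obtain d d' where d: "0 < d" "\<And>x. dist x x\<^sub>0 < d \<Longrightarrow> b < g x"
      and d': "0 < d'" "\<And>x. dist x (x\<^sub>0 + \<rho> *\<^sub>R u) < d' \<Longrightarrow> g x < a"
    unfolding eventually_nhds_metric by blast
  \<comment> \<open>Points of norm less than \<open>r\<close>, moved by at most \<open>r\<close>, stay within both neighbourhoods.\<close>
  define r where "r = min d d' / 2"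
  have "0 < r" using d d' by (simp add: r_def)
  define F where "F x = (\<integral>\<^sup>+s. g ((x\<^sub>0 + s *\<^sub>R u) + x) \<partial>density lborel (indicator {0..\<rho>}))" for x
  have F_eq: "F x = (\<integral>\<^sup>+s\<in>{0..\<rho>}. g ((x\<^sub>0 + s *\<^sub>R u) + x) \<partial>lborel)" for x
    unfolding F_def by (subst nn_integral_density) (auto simp: mult.commute)
  have F_mono: "perimeter_monotone F"
  proof -
    have "finite_measure (density lborel (indicator {0..\<rho>}))"
      by (intro finite_measureI) (simp add: emeasure_density \<open>0 \<le> \<rho>\<close>)
    then show ?thesis
      unfolding F_def
      by (intro perimeter_monotone_average[OF g_mono]) (auto intro: finite_measure.axioms(1))
  qed
  obtain K where K: "\<And>x. norm x \<le> norm x\<^sub>0 + \<rho> + 2 * r \<Longrightarrow> g x \<le> ennreal K"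
    using box_integral_bounded[OF f li, of "norm x\<^sub>0 + \<rho> + 2 * r" l h] by (auto simp: g_def)
  have bound: "F x \<le> ennreal (max 0 K * \<rho>)" if "norm x \<le> 2 * r" for x
  proof -
    have "F x \<le> (\<integral>\<^sup>+s. ennreal K * indicator {0..\<rho>} s \<partial>lborel)"
      unfolding F_eq
    proof (intro nn_integral_mono)
      fix s
      have "norm ((x\<^sub>0 + s *\<^sub>R u) + x) \<le> norm x\<^sub>0 + \<rho> + 2 * r" if "s \<in> {0..\<rho>}"
        using that \<open>norm x \<le> 2 * r\<close> \<open>norm u = 1\<close> norm_triangle_ineq[of "x\<^sub>0 + s *\<^sub>R u" x] norm_triangle_ineq[of x\<^sub>0 "s *\<^sub>R u"]
        by simp
      then show "g ((x\<^sub>0 + s *\<^sub>R u) + x) * indicator {0..\<rho>} s \<le> ennreal K * indicator {0..\<rho>} s"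
        using K by (auto split: split_indicator)
    qed
    also have "\<dots> = ennreal K * ennreal \<rho>"
      using \<open>0 \<le> \<rho>\<close> by (simp add: nn_integral_cmult)
    also have "\<dots> = ennreal (max 0 K * \<rho>)"
      using \<open>0 \<le> \<rho>\<close> by (simp add: ennreal_mult max_def ennreal_neg)
    finally show ?thesis .
  qed
  have "b < \<infinity>"
    using ab(3) by (rule order.strict_trans2) simp
  then have fin: "a < \<infinity>" "b - a < \<infinity>"
    using ab(2) by (auto simp: diff_less_top_ennreal less_top[symmetric] top_unique)
  then have "0 < b - a"
    using ab(2) diff_gr0_ennreal by simp
  define c where "c = enn2real (b - a)"
  have c: "0 < c" "b = a + ennreal c"
    using fin \<open>0 < b - a\<close> ab(2) by (auto simp: c_def enn2real_positive_iff less_top add_diff_inverse_ennreal)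
  show False
  proof (rule perimeter_monotone_no_decrease[OF F_mono bound u \<open>0 < r\<close> c(1)])
    fix x :: "real ^ 'n" and \<tau> :: real assume x: "norm x < r" and \<tau>: "0 \<le> \<tau>" "\<tau> \<le> r"
    define G where "G s = g ((x\<^sub>0 + s *\<^sub>R u) + x)" for s
    have [measurable]: "G \<in> borel_measurable borel"
      unfolding G_def by measurable
    have near: "norm (s *\<^sub>R u + x) < min d d'" if "0 \<le> s" "s \<le> \<tau>" for s
      using that x \<tau> norm_triangle_ineq[of "s *\<^sub>R u" x] \<open>norm u = 1\<close> by (simp add: r_def)
    have "(\<integral>\<^sup>+s\<in>{0..\<rho>}. G (\<tau> + s) \<partial>lborel) + b * ennreal \<tau> \<le> (\<integral>\<^sup>+s\<in>{0..\<rho>}. G s \<partial>lborel) + a * ennreal \<tau>"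
    proof (rule nn_integral_shift_le[OF _ \<tau>(1) \<open>0 \<le> \<rho>\<close>])
      show "b \<le> G s" if "0 \<le> s" "s \<le> \<tau>" for s
        unfolding G_def using near[OF that]
        by (intro less_imp_le d) (simp add: dist_norm add.assoc)
      show "G s \<le> a" if "\<rho> \<le> s" "s \<le> \<rho> + \<tau>" for s
        unfolding G_def using near[of "s - \<rho>"] that
        by (intro less_imp_le d') (simp add: dist_norm algebra_simps)
    qed measurable
    moreover have "(\<integral>\<^sup>+s\<in>{0..\<rho>}. G s \<partial>lborel) = F x"
      by (simp add: F_eq G_def)
    moreover have "(\<integral>\<^sup>+s\<in>{0..\<rho>}. G (\<tau> + s) \<partial>lborel) = F (x + \<tau> *\<^sub>R u)"
      by (simp add: F_eq G_def algebra_simps)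
    moreover have "b * ennreal \<tau> = ennreal (c * \<tau>) + a * ennreal \<tau>"
      using \<tau>(1) c by (simp add: distrib_right ennreal_mult add.commute)
    moreover have "a * ennreal \<tau> \<noteq> \<infinity>"
      using fin(1) by (simp add: ennreal_mult_eq_top_iff)
    ultimately show "F (x + \<tau> *\<^sub>R u) + ennreal (c * \<tau>) \<le> F x"
      by (simp add: ennreal_add_left_cancel_le add.commute[of _ "a * ennreal \<tau>"] add.left_commute[of _ "a * ennreal \<tau>"])
  qed
qed

text \<open>
  Any \<open>x\<close> is reached from the origin by steps parallel to the axes, and monotonicity along both \<open>b\<close> and \<open>-b\<close>
  means that such a step does not change the value.
\<close>

lemma box_integral_constant:
  fixes f :: "real ^ 'n \<Rightarrow> ennreal"
  assumes "perimeter_monotone f" "locally_integrable f"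
  shows "box_integral f l h x = box_integral f l h 0"
proof -
  let ?g = "box_integral f l h"
  have step: "?g (z + s *\<^sub>R b) = ?g z" if b: "b \<in> Basis" for z s b
  proof -
    have "?g (z + s *\<^sub>R b) = ?g z" if "0 \<le> s" for z s
    proof (rule antisym)
      show "?g z \<le> ?g (z + s *\<^sub>R b)"
        using b that by (intro box_integral_directional_mono assms) auto
      have "?g (z + s *\<^sub>R b) \<le> ?g ((z + s *\<^sub>R b) + s *\<^sub>R (- b))"
        using b that by (intro box_integral_directional_mono assms) auto
      then show "?g (z + s *\<^sub>R b) \<le> ?g z" by simp
    qed
    from this[of s z] this[of "- s" "z + s *\<^sub>R b"] show ?thesis
      by (cases "0 \<le> s") auto
  qed
  have "?g (\<Sum>b\<in>S. (x \<bullet> b) *\<^sub>R b) = ?g 0" if "finite S" "S \<subseteq> Basis" for S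
    using that
  proof (induction S)
    case (insert b S)
    then show ?case
      using step[of b "\<Sum>b\<in>S. (x \<bullet> b) *\<^sub>R b" "x \<bullet> b"] by (simp add: add.commute)
  qed simp
  from this[of Basis] show ?thesis
    by (simp add: euclidean_representation)
qed

theorem theorem1p1:
  fixes f :: "real ^ 'n \<Rightarrow> ennreal"
  assumes "CARD('n) \<ge> 2"
    and "f \<in> borel_measurable borel"
    and "locally_integrable f"
    and "\<And>A B. convex_body A \<Longrightarrow> convex_body B \<Longrightarrow> A \<subseteq> B \<Longrightarrow>
           weighted_perimeter f A \<le> weighted_perimeter f B"
  shows "\<exists>c::real. c \<ge> 0 \<and> (AE x in lebesgue. f x = ennreal c)"
proof -
  have "perimeter_monotone f"
    using assms(2,4) by (simp add: perimeter_monotone_def)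
  then show ?thesis
    using assms(2,3) by (intro AE_constant_if_box_integrals_constant box_integral_constant)
qed

end
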